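(* Let $n \geq 1$ be an integer whose prime decomposition $n = p_1^{y_1}\cdots p_r^{y_r}$ (the $p_i$ pairwise distinct primes, $y_i > 0$) involves at least two primes, i.e. $r \geq 2$. Then the $R_\infty$-nilpotency degree of the Generalized Solvable Baumslag-Solitar group $\Gamma_n$ is infinite; that is, for every integer $c \geq 1$ the nilpotent quotient $\Gamma_n/\gamma_{c+1}(\Gamma_n)$ does not have property $R_\infty$.
   Context: For $n = p_1^{y_1}\cdots p_r^{y_r}$ with $p_1,\dots,p_r$ pairwise distinct primes and $y_i>0$, the Generalized Solvable Baumslag-Solitar group is $$\Gamma_n=\left\langle a,t_1,\dots,t_r \ \middle|\ t_it_j=t_jt_i\ (i\neq j),\ t_i a t_i^{-1}=a^{p_i^{y_i}}\ (1\le i\le r)\right\rangle.$$ The lower central series of a group $G$ is $\gamma_1(G)=G$, $\gamma_{c+1}(G)=[\gamma_c(G),G]$ for $c\ge 1$. For an automorphism $\varphi$ of a group $G$, the twisted conjugacy relation on $G$ is $x\sim_\varphi y \iff \exists z\in G:\ zx\varphi(z)^{-1}=y$. The (possibly infinite) number of its equivalence classes is denoted $R(\varphi)$. The group $G$ has property $R_\infty$ if $R(\varphi)=\infty$ for every automorphism $\varphi$ of $G$. For a group $G$ with property $R_\infty$ (the groups $\Gamma_n$ are known to have it), the $R_\infty$-nilpotency degree of $G$ is the least integer $c\ge 1$ such that $G/\gamma_{c+1}(G)$ has property $R_\infty$; if no such quotient has property $R_\infty$, the degree is said to be infinite. *)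

theory Defs
  imports
    "HOL-Algebra.Generated_Groups"
    "HOL-Computational_Algebra.Primes"
    "HOL-Library.Extended_Nat"
begin

section \<open>Groups given by generators and relations\<close>

text \<open>
  A word over \<open>S\<close> is a list of letters, \<open>(x, True)\<close> standing for \<open>x\<close> and \<open>(x, False)\<close> for
  \<open>x\<inverse>\<close>.  A relation \<open>u = v\<close> is the pair \<open>(u, v)\<close>; pairs that are not made of words over \<open>S\<close>
  are ignored.
\<close>

type_synonym 'g word = "('g \<times> bool) list"

abbreviation words :: "'g set \<Rightarrow> 'g word set" where
  "words S \<equiv> lists (S \<times> UNIV)"

inductive_set pres_rel :: "'g set \<Rightarrow> ('g word \<times> 'g word) set \<Rightarrow> ('g word \<times> 'g word) set"
  for S :: "'g set" and R :: "('g word \<times> 'g word) set"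
where
  relation: "(u, v) \<in> R \<Longrightarrow> u \<in> words S \<Longrightarrow> v \<in> words S \<Longrightarrow> (u, v) \<in> pres_rel S R"
| cancel: "x \<in> S \<Longrightarrow> ([(x, b), (x, \<not> b)], []) \<in> pres_rel S R"
| refl: "w \<in> words S \<Longrightarrow> (w, w) \<in> pres_rel S R"
| sym: "(u, v) \<in> pres_rel S R \<Longrightarrow> (v, u) \<in> pres_rel S R"
| trans: "(u, v) \<in> pres_rel S R \<Longrightarrow> (v, w) \<in> pres_rel S R \<Longrightarrow> (u, w) \<in> pres_rel S R"
| cong: "(u, u') \<in> pres_rel S R \<Longrightarrow> (v, v') \<in> pres_rel S R \<Longrightarrow> (u @ v, u' @ v') \<in> pres_rel S R"

definition presented_group :: "'g set \<Rightarrow> ('g word \<times> 'g word) set \<Rightarrow> 'g word set monoid" where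
  "presented_group S R =
     \<lparr>carrier = words S // pres_rel S R,
      monoid.mult = (\<lambda>U V. \<Union>u\<in>U. \<Union>v\<in>V. pres_rel S R `` {u @ v}),
      one = pres_rel S R `` {[]}\<rparr>"

lemma pres_rel_words: "(u, v) \<in> pres_rel S R \<Longrightarrow> u \<in> words S \<and> v \<in> words S"
  by (induction rule: pres_rel.induct) auto

lemma equiv_pres_rel: "equiv (words S) (pres_rel S R)"
proof (rule equivI)
  show "pres_rel S R \<subseteq> words S \<times> words S"
    using pres_rel_words by fast
  show "refl_on (words S) (pres_rel S R)"
    by (auto simp: refl_on_def intro: pres_rel.refl)
  show "sym (pres_rel S R)"
    by (auto intro!: symI intro: pres_rel.sym)
  show "trans (pres_rel S R)"
    by (rule transI) (rule pres_rel.trans)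
qed

lemma presented_group_carrier:
  "carrier (presented_group S R) = words S // pres_rel S R"
  by (simp add: presented_group_def)

lemma presented_group_one: "\<one>\<^bsub>presented_group S R\<^esub> = pres_rel S R `` {[]}"
  by (simp add: presented_group_def)

lemma presented_group_mult:
  assumes "u \<in> words S" "v \<in> words S"
  shows "pres_rel S R `` {u} \<otimes>\<^bsub>presented_group S R\<^esub> pres_rel S R `` {v} = pres_rel S R `` {u @ v}"
proof -
  have "congruent2 (pres_rel S R) (pres_rel S R) (\<lambda>u v. pres_rel S R `` {u @ v})"
    by (intro congruent2I' equiv_class_eq[OF equiv_pres_rel] pres_rel.cong)
  from UN_equiv_class2[OF equiv_pres_rel equiv_pres_rel this assms] show ?thesis
    by (simp add: presented_group_def)
qed

lemma pres_rel_left_inverse: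
  assumes "w \<in> words S"
  shows "\<exists>w'\<in>words S. (w' @ w, []) \<in> pres_rel S R"
  using assms
proof (induction w)
  case Nil
  then show ?case by (auto intro!: bexI[of _ "[]"] pres_rel.refl)
next
  case (Cons l w)
  then obtain x b where l: "l = (x, b)" "x \<in> S" and w: "w \<in> words S" by (cases l) auto
  from Cons obtain w' where w': "w' \<in> words S" "(w' @ w, []) \<in> pres_rel S R" by auto
  have c: "([(x, \<not> b), (x, b)], []) \<in> pres_rel S R"
    using pres_rel.cancel[OF l(2), of "\<not> b"] by simp
  have "(w' @ ([(x, \<not> b), (x, b)] @ w), w' @ ([] @ w)) \<in> pres_rel S R"
    by (intro pres_rel.cong c pres_rel.refl w w'(1))
  then have "((w' @ [(x, \<not> b)]) @ (l # w), []) \<in> pres_rel S R"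
    using w'(2) by (auto simp: l intro: pres_rel.trans)
  moreover have "w' @ [(x, \<not> b)] \<in> words S" using w'(1) l(2) by auto
  ultimately show ?case by blast
qed

lemma group_presented_group: "group (presented_group S R)"
proof (rule groupI, goal_cases)
  case (1 U V)
  then obtain u v where uv: "u \<in> words S" "v \<in> words S"
    "U = pres_rel S R `` {u}" "V = pres_rel S R `` {v}"
    unfolding presented_group_carrier by (elim quotientE) blast
  then have "u @ v \<in> words S" by simp
  from quotientI[OF this] uv show ?case
    by (simp add: presented_group_carrier presented_group_mult del: in_lists_conv_set)
next
  case 2
  show ?case by (auto simp: presented_group_carrier presented_group_one intro!: quotientI)
next
  case (3 U V W)
  then obtain u v w where "u \<in> words S" "v \<in> words S" "w \<in> words S"
    "U = pres_rel S R `` {u}" "V = pres_rel S R `` {v}" "W = pres_rel S R `` {w}"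
    unfolding presented_group_carrier by (elim quotientE) blast
  then show ?case by (simp add: presented_group_mult del: in_lists_conv_set)
next
  case (4 U)
  then obtain u where "u \<in> words S" "U = pres_rel S R `` {u}"
    unfolding presented_group_carrier by (elim quotientE) blast
  then show ?case
    by (simp add: presented_group_one presented_group_mult del: in_lists_conv_set)
next
  case (5 U)
  then obtain u where u: "u \<in> words S" "U = pres_rel S R `` {u}"
    unfolding presented_group_carrier by (elim quotientE) blast
  obtain u' where u': "u' \<in> words S" "(u' @ u, []) \<in> pres_rel S R"
    using pres_rel_left_inverse[OF u(1)] by blast
  show ?case
  proof
    show "pres_rel S R `` {u'} \<otimes>\<^bsub>presented_group S R\<^esub> U = \<one>\<^bsub>presented_group S R\<^esub>"
      using u u' by (simp add: presented_group_mult presented_group_one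
          equiv_class_eq[OF equiv_pres_rel])
    show "pres_rel S R `` {u'} \<in> carrier (presented_group S R)"
      using u'(1) by (simp add: presented_group_carrier quotientI)
  qed
qed


section \<open>Generalized Solvable Baumslag-Solitar groups\<close>

text \<open>
  The generators \<open>t\<close> are indexed by the prime factors of \<open>n\<close> themselves, so that no enumeration of
  these has to be chosen; the prime power belonging to \<open>p\<close> is \<open>p ^ multiplicity p n\<close>.
\<close>

datatype gsbs_gen = Gen_a | Gen_t nat

definition gsbs_gens :: "nat \<Rightarrow> gsbs_gen set" where
  "gsbs_gens n = insert Gen_a (Gen_t ` prime_factors n)"

definition gsbs_rels :: "nat \<Rightarrow> (gsbs_gen word \<times> gsbs_gen word) set" where
  "gsbs_rels n =
     {([(Gen_t p, True), (Gen_t q, True)], [(Gen_t q, True), (Gen_t p, True)]) | p q.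
        p \<in> prime_factors n \<and> q \<in> prime_factors n \<and> p \<noteq> q} \<union>
     {([(Gen_t p, True), (Gen_a, True), (Gen_t p, False)],
       replicate (p ^ multiplicity p n) (Gen_a, True)) | p. p \<in> prime_factors n}"

definition GSBS :: "nat \<Rightarrow> gsbs_gen word set monoid" where
  "GSBS n = presented_group (gsbs_gens n) (gsbs_rels n)"

lemma group_GSBS: "group (GSBS n)"
  by (simp add: GSBS_def group_presented_group)

lemma gsbs_rels_words: "gsbs_rels n \<subseteq> words (gsbs_gens n) \<times> words (gsbs_gens n)"
  by (auto simp: gsbs_rels_def gsbs_gens_def)


section \<open>Lower central series\<close>

definition commutator_subgroup :: "('a, 'b) monoid_scheme \<Rightarrow> 'a set \<Rightarrow> 'a set \<Rightarrow> 'a set" where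
  "commutator_subgroup G H K =
     generate G (\<Union>h\<in>H. \<Union>k\<in>K. {h \<otimes>\<^bsub>G\<^esub> k \<otimes>\<^bsub>G\<^esub> inv\<^bsub>G\<^esub> h \<otimes>\<^bsub>G\<^esub> inv\<^bsub>G\<^esub> k})"

text \<open>The numbering starts at 1; the value at 0 is a dummy.\<close>

fun lower_central :: "('a, 'b) monoid_scheme \<Rightarrow> nat \<Rightarrow> 'a set" where
  "lower_central G 0 = carrier G"
| "lower_central G (Suc 0) = carrier G"
| "lower_central G (Suc (Suc c)) = commutator_subgroup G (lower_central G (Suc c)) (carrier G)"

lemma (in group) commutator_subgroup_normal:
  assumes "H \<lhd> G" "K \<lhd> G"
  shows "commutator_subgroup G H K \<lhd> G"
proof -
  interpret H: normal H G by fact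
  interpret K: normal K G by fact
  let ?C = "\<Union>h\<in>H. \<Union>k\<in>K. {h \<otimes> k \<otimes> inv h \<otimes> inv k}"
  have "generate G ?C \<lhd> G"
  proof (rule normal_generateI)
    show "?C \<subseteq> carrier G" by (auto intro!: m_closed inv_closed)
    fix c g assume "c \<in> ?C" and g: "g \<in> carrier G"
    then obtain h k where hk: "h \<in> H" "k \<in> K" and c: "c = h \<otimes> k \<otimes> inv h \<otimes> inv k" by auto
    have hk': "h \<in> carrier G" "k \<in> carrier G" using hk by auto
    have cancel: "inv y \<otimes> (y \<otimes> x) = x" if "y \<in> carrier G" "x \<in> carrier G" for x y
      using that by (simp add: m_assoc[symmetric])
    let ?h = "g \<otimes> h \<otimes> inv g" and ?k = "g \<otimes> k \<otimes> inv g"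
    have "?h \<in> H" "?k \<in> K"
      using hk g H.inv_op_closed2 K.inv_op_closed2 by auto
    moreover have "g \<otimes> c \<otimes> inv g = ?h \<otimes> ?k \<otimes> inv ?h \<otimes> inv ?k"
      using g hk' cancel[OF g] unfolding c by (simp add: m_assoc inv_mult_group)
    ultimately show "g \<otimes> c \<otimes> inv g \<in> ?C" by blast
  qed
  then show ?thesis by (simp add: commutator_subgroup_def)
qed

lemma (in group) lower_central_normal: "lower_central G c \<lhd> G"
proof (induction c)
  case 0
  show ?case by (simp add: normal_self)
next
  case (Suc c)
  then show ?case by (cases c) (simp_all add: normal_self commutator_subgroup_normal)
qed


section \<open>Twisted conjugacy and property \<open>R\<^sub>\<infinity>\<close>\<close>

definition twisted_conj :: "('a, 'b) monoid_scheme \<Rightarrow> ('a \<Rightarrow> 'a) \<Rightarrow> ('a \<times> 'a) set" where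
  "twisted_conj G \<phi> =
     {(x, y). x \<in> carrier G \<and> y \<in> carrier G \<and>
        (\<exists>z\<in>carrier G. z \<otimes>\<^bsub>G\<^esub> x \<otimes>\<^bsub>G\<^esub> inv\<^bsub>G\<^esub> (\<phi> z) = y)}"

definition reidemeister_number :: "('a, 'b) monoid_scheme \<Rightarrow> ('a \<Rightarrow> 'a) \<Rightarrow> enat" where
  "reidemeister_number G \<phi> =
     (if finite (carrier G // twisted_conj G \<phi>)
      then enat (card (carrier G // twisted_conj G \<phi>)) else \<infinity>)"

definition has_R_infinity :: "('a, 'b) monoid_scheme \<Rightarrow> bool" where
  "has_R_infinity G \<longleftrightarrow> (\<forall>\<phi>\<in>iso G G. reidemeister_number G \<phi> = \<infinity>)"

text \<open>The infimum of the empty set is \<open>\<infinity>\<close> in \<^typ>\<open>enat\<close>.\<close>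

definition R_infinity_nilpotency_degree :: "('a, 'b) monoid_scheme \<Rightarrow> enat" where
  "R_infinity_nilpotency_degree G =
     Inf {enat c | c. c \<ge> 1 \<and> has_R_infinity (G Mod lower_central G (c + 1))}"

end

theory Submission
  imports Defs "HOL-Number_Theory.Residues"
begin

text \<open>
  Write \<open>q\<^sub>p\<close> for the prime power belonging to \<open>p\<close> and let \<open>Q\<close> be the quotient of the group by
  \<open>\<gamma>\<^sub>c\<^sub>+\<^sub>1\<close>. A commutator of \<open>t\<^sub>p\<close> with a power of \<open>a\<close> multiplies the exponent by \<open>q\<^sub>p - 1\<close> up to sign,
  so \<open>a\<close> to the power \<open>(q\<^sub>p - 1)\<^bsup>c\<^esup>\<close> is trivial in \<open>Q\<close> (\<open>pow_mem_lower_central\<close>). Thus \<open>Q\<close> is an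
  extension of the finite cyclic group of \<open>a\<close> by a finitely generated abelian group, and by
  Euler's theorem some power \<open>t\<^sub>p\<^bsup>k\<^esup>\<close> with \<open>k > 0\<close> is central for all \<open>p\<close> at once
  (\<open>power_exponent_cong_1\<close>).

  Changing the \<open>t\<^sub>p\<close> by central factors preserves the relations. If \<open>p \<noteq> s\<close>, the transvection
  \<open>t\<^sub>p \<mapsto> t\<^sub>p t\<^sub>s\<^bsup>k m\<^esup>\<close> that fixes \<open>a\<close> and the other generators is therefore an automorphism of \<open>Q\<close>
  (\<open>transvection_iso\<close>). On exponent vectors the transvections generate automorphisms that are
  congruent to the identity modulo \<open>k\<close>, and with at least two primes a suitable product \<open>\<phi>\<close> of them
  does not have the eigenvalue \<open>1\<close>; an explicit choice is made in \<open>not_R_infinity\<close>.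

  For central \<open>z\<close>, an element \<open>x\<close> is twisted conjugate to \<open>x z \<phi>(z)\<inverse>\<close>. For the chosen \<open>\<phi>\<close> the central
  elements of the form \<open>z \<phi>(z)\<inverse>\<close> with central \<open>z\<close> include all \<open>t\<^sub>p\<close> to the power \<open>k\<^sup>2\<close>, so they form a
  subgroup of finite index (\<open>finite_mod_central\<close>) and the Reidemeister number of \<open>\<phi>\<close> is finite
  (\<open>reidemeister_number_finite\<close>). Hence no quotient has property \<open>R\<^sub>\<infinity>\<close>, and the degree is the infimum
  of the empty set.
\<close>

section \<open>Centre, powers and generators of a group\<close>

definition centre :: "('a, 'b) monoid_scheme \<Rightarrow> 'a set" where
  "centre G = {z \<in> carrier G. \<forall>x\<in>carrier G. z \<otimes>\<^bsub>G\<^esub> x = x \<otimes>\<^bsub>G\<^esub> z}"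

lemma centre_closed: "z \<in> centre G \<Longrightarrow> z \<in> carrier G"
  and centre_comm: "z \<in> centre G \<Longrightarrow> x \<in> carrier G \<Longrightarrow> z \<otimes>\<^bsub>G\<^esub> x = x \<otimes>\<^bsub>G\<^esub> z"
  unfolding centre_def by blast+

lemma (in group) inv_commute:
  assumes "x \<otimes> y = y \<otimes> x" "x \<in> carrier G" "y \<in> carrier G"
  shows "inv x \<otimes> y = y \<otimes> inv x"
proof -
  have "inv x \<otimes> y = inv x \<otimes> (y \<otimes> x) \<otimes> inv x" using assms(2,3) by (simp add: m_assoc)
  also have "\<dots> = inv x \<otimes> (x \<otimes> y) \<otimes> inv x" by (simp only: assms(1))
  also have "\<dots> = y \<otimes> inv x" using assms(2,3) by (simp add: m_assoc[symmetric])
  finally show ?thesis .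
qed

lemma (in group) inv_swap:
  assumes "inv x \<otimes> y = y' \<otimes> inv x" "x \<in> carrier G" "y \<in> carrier G" "y' \<in> carrier G"
  shows "y \<otimes> x = x \<otimes> y'"
proof -
  have "y \<otimes> x = x \<otimes> (inv x \<otimes> y) \<otimes> x" using assms(2,3) by (simp add: m_assoc[symmetric])
  also have "\<dots> = x \<otimes> (y' \<otimes> inv x) \<otimes> x" by (simp only: assms(1))
  also have "\<dots> = x \<otimes> y'" using assms(2,4) by (simp add: m_assoc)
  finally show ?thesis .
qed

lemma (in group) centre_subgroup: "subgroup (centre G) G"
proof (rule subgroupI)
  show "centre G \<subseteq> carrier G" by (rule subsetI) (rule centre_closed)
  have "\<one> \<in> centre G" by (simp add: centre_def)
  then show "centre G \<noteq> {}" by blast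
next
  fix z assume "z \<in> centre G"
  then show "inv z \<in> centre G"
    unfolding centre_def[of G] by (blast intro: inv_commute)
next
  fix y z assume y: "y \<in> centre G" and z: "z \<in> centre G"
  note cl = y[THEN centre_closed] z[THEN centre_closed]
  have "y \<otimes> z \<otimes> x = x \<otimes> (y \<otimes> z)" if x: "x \<in> carrier G" for x
  proof -
    have "y \<otimes> z \<otimes> x = y \<otimes> (x \<otimes> z)" using cl x centre_comm[OF z x] by (simp add: m_assoc)
    also have "\<dots> = x \<otimes> (y \<otimes> z)" using cl x centre_comm[OF y x] by (simp add: m_assoc[symmetric])
    finally show ?thesis .
  qed
  then show "y \<otimes> z \<in> centre G" using cl by (simp add: centre_def)
qed

lemma (in group) int_pow_commute:
  assumes "x \<otimes> y = y \<otimes> x" "x \<in> carrier G" "y \<in> carrier G"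
  shows "x [^] (i::int) \<otimes> y = y \<otimes> x [^] i"
proof -
  have *: "x [^] (n::nat) \<otimes> y = y \<otimes> x [^] n" for n
    using group_commutes_pow[OF assms] .
  show ?thesis
  proof (cases i rule: int_cases2)
    case (nonneg n)
    then show ?thesis using * by (simp add: int_pow_int)
  next
    case (nonpos n)
    then show ?thesis using *[of n] assms by (simp add: int_pow_neg_int inv_commute)
  qed
qed

lemma (in group) int_pow_closed_subgroup:
  assumes "subgroup H G" "x \<in> H"
  shows "x [^] (i::int) \<in> H"
proof -
  interpret H: subgroup H G by fact
  have "x [^] (n::nat) \<in> H" for n
    by (induction n) (use assms in auto)
  then show ?thesis by (cases i rule: int_cases2) (use assms in \<open>auto simp: int_pow_int int_pow_neg_int\<close>)
qed

lemma (in group) int_pow_conjugate: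
  assumes "x \<in> carrier G" "y \<in> carrier G"
  shows "y \<otimes> x [^] (i::int) \<otimes> inv y = (y \<otimes> x \<otimes> inv y) [^] i"
proof -
  have "(\<lambda>x. y \<otimes> x \<otimes> inv y) \<in> hom G G"
  proof (rule homI)
    fix u v assume uv: "u \<in> carrier G" "v \<in> carrier G"
    have "y \<otimes> (u \<otimes> v) \<otimes> inv y = y \<otimes> u \<otimes> (inv y \<otimes> y) \<otimes> v \<otimes> inv y"
      using uv assms(2) by (simp add: m_assoc)
    then show "y \<otimes> (u \<otimes> v) \<otimes> inv y = (y \<otimes> u \<otimes> inv y) \<otimes> (y \<otimes> v \<otimes> inv y)"
      using uv assms(2) by (simp only: m_assoc m_closed inv_closed)
  qed (use assms in auto)
  then show ?thesis
    using hom_int_pow[of "\<lambda>x. y \<otimes> x \<otimes> inv y" G G x i] assms group_axioms by simp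
qed

lemma (in group) central_normal:
  assumes "subgroup D G" "D \<subseteq> centre G"
  shows "D \<lhd> G"
proof -
  interpret D: subgroup D G by fact
  have "x \<otimes> d \<otimes> inv x \<in> D" if "x \<in> carrier G" "d \<in> D" for x d
  proof -
    have "d \<otimes> x = x \<otimes> d" using that assms(2) by (intro centre_comm) auto
    then have "x \<otimes> d \<otimes> inv x = d"
      using that by (metis D.mem_carrier inv_solve_right m_closed)
    then show ?thesis using that by simp
  qed
  then show ?thesis using assms(1) by (simp add: normal_inv_iff)
qed

text \<open>
  Membership in a generated subgroup is tested by letting the generators and their inverses act
  from the left on a set; unlike a subgroup, that set may be given by a normal form.
\<close>

lemma (in group) generate_induct_left:
  assumes "X \<subseteq> carrier G" "V \<subseteq> carrier G" "x \<in> generate G X"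
    and "\<one> \<in> V"
    and "\<And>g v. g \<in> X \<Longrightarrow> v \<in> V \<Longrightarrow> g \<otimes> v \<in> V"
    and "\<And>g v. g \<in> X \<Longrightarrow> v \<in> V \<Longrightarrow> inv g \<otimes> v \<in> V"
  shows "x \<in> V"
proof -
  have "\<forall>v\<in>V. x \<otimes> v \<in> V" using assms(3)
  proof (induction rule: generate.induct)
    case (eng g h)
    then have "g \<in> carrier G" "h \<in> carrier G" using assms(1) generate_in_carrier by auto
    then show ?case using eng assms(2) m_assoc by (metis subsetD)
  qed (use assms in auto)
  moreover have "x \<in> carrier G" using assms(1,3) generate_in_carrier by auto
  ultimately show ?thesis using assms(4) by force
qed

lemma hom_eq_on_generate:
  assumes "group G" "group H" "f \<in> hom G H" "g \<in> hom G H" "X \<subseteq> carrier G"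
    and "\<And>x. x \<in> X \<Longrightarrow> f x = g x" and "x \<in> generate G X"
  shows "f x = g x"
proof -
  interpret f: group_hom G H f by (simp add: assms group_hom_def group_hom_axioms_def)
  interpret g: group_hom G H g by (simp add: assms group_hom_def group_hom_axioms_def)
  show ?thesis using assms(7)
  proof (induction rule: generate.induct)
    case (eng x y)
    then show ?case using f.G.generate_in_carrier[OF assms(5)] by simp
  next
    case (inv x)
    then have "x \<in> carrier G" using assms(5) by auto
    then show ?case using assms(6)[OF inv] by simp
  qed (use assms(6) in auto)
qed

lemma inverse_homs_iso:
  assumes "f \<in> hom G G" "g \<in> hom G G"
    and "\<And>x. x \<in> carrier G \<Longrightarrow> g (f x) = x" "\<And>x. x \<in> carrier G \<Longrightarrow> f (g x) = x"
  shows "f \<in> iso G G"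
proof -
  have "bij_betw f (carrier G) (carrier G)"
    by (rule bij_betw_byWitness[where f' = g]) (use assms in \<open>auto simp: hom_def\<close>)
  then show ?thesis using assms(1) by (simp add: iso_def)
qed

lemma generate_quotient:
  assumes "N \<lhd> G" "carrier G = generate G X" "X \<subseteq> carrier G"
  shows "carrier (G Mod N) = generate (G Mod N) ((\<lambda>x. N #>\<^bsub>G\<^esub> x) ` X)"
proof -
  interpret N: normal N G by fact
  interpret group_hom G "G Mod N" "\<lambda>x. N #>\<^bsub>G\<^esub> x"
    using N.factorgroup_is_group N.r_coset_hom_Mod N.group_axioms
    by (simp add: group_hom_def group_hom_axioms_def)
  show ?thesis using generate_img[OF assms(3)] assms(2) by (simp add: carrier_FactGroup)
qed

section \<open>A criterion for a finite Reidemeister number\<close>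

text \<open>
  If \<open>z\<close> is central then \<open>z x \<phi>(z)\<inverse> = x (z \<phi>(z)\<inverse>)\<close>, so twisted conjugation by central elements is
  translation by \<open>z \<phi>(z)\<inverse>\<close>. Collecting those translations that are central themselves gives, for
  every endomorphism \<open>\<phi>\<close>, a subgroup of the centre whose cosets lie inside twisted conjugacy classes.
\<close>

definition twist_centre :: "('a, 'b) monoid_scheme \<Rightarrow> ('a \<Rightarrow> 'a) \<Rightarrow> 'a set" where
  "twist_centre G \<phi> = {u \<in> centre G. \<exists>z\<in>centre G. u = z \<otimes>\<^bsub>G\<^esub> inv\<^bsub>G\<^esub> (\<phi> z)}"

text \<open>
  Centrality of the collected elements is what makes \<open>z \<mapsto> z \<phi>(z)\<inverse>\<close> behave as a homomorphism:
  \<open>y z \<phi>(y z)\<inverse> = y (z \<phi>(z)\<inverse>) \<phi>(y)\<inverse>\<close>, and the bracket can be moved to the front.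
\<close>

lemma twist_centre_subgroup:
  assumes "group G" "\<phi> \<in> hom G G"
  shows "subgroup (twist_centre G \<phi>) G"
proof -
  interpret group_hom G G \<phi> by (simp add: assms group_hom_def group_hom_axioms_def)
  interpret Z: subgroup "centre G" G by (rule centre_subgroup)
  have comm: "z \<otimes>\<^bsub>G\<^esub> x = x \<otimes>\<^bsub>G\<^esub> z" if "z \<in> centre G" "x \<in> carrier G" for x z
    using that by (rule centre_comm)
  show ?thesis
  proof (rule G.subgroupI)
    show "twist_centre G \<phi> \<subseteq> carrier G" by (auto simp: twist_centre_def)
    have "\<one>\<^bsub>G\<^esub> \<in> twist_centre G \<phi>"
      unfolding twist_centre_def using Z.one_closed by (intro CollectI conjI bexI[of _ "\<one>\<^bsub>G\<^esub>"]) simp_all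
    then show "twist_centre G \<phi> \<noteq> {}" by blast
  next
    fix u assume "u \<in> twist_centre G \<phi>"
    then obtain z where u: "u \<in> centre G" "z \<in> centre G" "u = z \<otimes>\<^bsub>G\<^esub> inv\<^bsub>G\<^esub> (\<phi> z)"
      by (auto simp: twist_centre_def)
    have "inv\<^bsub>G\<^esub> u = \<phi> z \<otimes>\<^bsub>G\<^esub> inv\<^bsub>G\<^esub> z"
      using u by (simp add: G.inv_mult_group)
    also have "\<dots> = inv\<^bsub>G\<^esub> z \<otimes>\<^bsub>G\<^esub> inv\<^bsub>G\<^esub> (\<phi> (inv\<^bsub>G\<^esub> z))"
      using u comm[of "inv\<^bsub>G\<^esub> z" "\<phi> z"] by simp
    finally show "inv\<^bsub>G\<^esub> u \<in> twist_centre G \<phi>"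
      unfolding twist_centre_def using Z.m_inv_closed[OF u(1)] Z.m_inv_closed[OF u(2)] by blast
  next
    fix u v assume "u \<in> twist_centre G \<phi>" "v \<in> twist_centre G \<phi>"
    then obtain y z where u: "u \<in> centre G" "y \<in> centre G" "u = y \<otimes>\<^bsub>G\<^esub> inv\<^bsub>G\<^esub> (\<phi> y)"
      and v: "v \<in> centre G" "z \<in> centre G" "v = z \<otimes>\<^bsub>G\<^esub> inv\<^bsub>G\<^esub> (\<phi> z)"
      by (auto simp: twist_centre_def)
    have "y \<otimes>\<^bsub>G\<^esub> z \<otimes>\<^bsub>G\<^esub> inv\<^bsub>G\<^esub> (\<phi> (y \<otimes>\<^bsub>G\<^esub> z)) = y \<otimes>\<^bsub>G\<^esub> v \<otimes>\<^bsub>G\<^esub> inv\<^bsub>G\<^esub> (\<phi> y)"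
      using u(2) v(2) by (simp add: v(3) G.inv_mult_group G.m_assoc)
    also have "\<dots> = v \<otimes>\<^bsub>G\<^esub> u"
      using u(2) v(1) comm[of v y] by (simp add: u(3) G.m_assoc[symmetric])
    also have "\<dots> = u \<otimes>\<^bsub>G\<^esub> v" using u v comm by simp
    finally show "u \<otimes>\<^bsub>G\<^esub> v \<in> twist_centre G \<phi>"
      unfolding twist_centre_def
      using Z.m_closed[OF u(1) v(1)] Z.m_closed[OF u(2) v(2)] by (metis (mono_tags, lifting) mem_Collect_eq)
  qed
qed

lemma equiv_twisted_conj:
  assumes "group G" "\<phi> \<in> hom G G"
  shows "equiv (carrier G) (twisted_conj G \<phi>)"
proof -
  interpret group_hom G G \<phi> by (simp add: assms group_hom_def group_hom_axioms_def)
  show ?thesis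
  proof (rule equivI)
    show "twisted_conj G \<phi> \<subseteq> carrier G \<times> carrier G" by (auto simp: twisted_conj_def)
    show "refl_on (carrier G) (twisted_conj G \<phi>)"
      by (auto simp: refl_on_def twisted_conj_def intro!: bexI[of _ "\<one>\<^bsub>G\<^esub>"])
    show "sym (twisted_conj G \<phi>)"
    proof (rule symI)
      fix x y assume "(x, y) \<in> twisted_conj G \<phi>"
      then obtain z where z: "x \<in> carrier G" "z \<in> carrier G" "y = z \<otimes>\<^bsub>G\<^esub> x \<otimes>\<^bsub>G\<^esub> inv\<^bsub>G\<^esub> (\<phi> z)"
        by (auto simp: twisted_conj_def)
      have "inv\<^bsub>G\<^esub> z \<otimes>\<^bsub>G\<^esub> y \<otimes>\<^bsub>G\<^esub> inv\<^bsub>G\<^esub> (\<phi> (inv\<^bsub>G\<^esub> z)) = x"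
        using z by (simp add: G.m_assoc) (simp add: G.m_assoc[symmetric])
      then show "(y, x) \<in> twisted_conj G \<phi>"
        using z by (auto simp: twisted_conj_def intro!: bexI[of _ "inv\<^bsub>G\<^esub> z"])
    qed
    show "trans (twisted_conj G \<phi>)"
    proof (rule transI)
      fix x y w assume "(x, y) \<in> twisted_conj G \<phi>" "(y, w) \<in> twisted_conj G \<phi>"
      then obtain z z' where z: "x \<in> carrier G" "z \<in> carrier G" "y = z \<otimes>\<^bsub>G\<^esub> x \<otimes>\<^bsub>G\<^esub> inv\<^bsub>G\<^esub> (\<phi> z)"
        and z': "z' \<in> carrier G" "w = z' \<otimes>\<^bsub>G\<^esub> y \<otimes>\<^bsub>G\<^esub> inv\<^bsub>G\<^esub> (\<phi> z')"
        by (auto simp: twisted_conj_def)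
      have "(z' \<otimes>\<^bsub>G\<^esub> z) \<otimes>\<^bsub>G\<^esub> x \<otimes>\<^bsub>G\<^esub> inv\<^bsub>G\<^esub> (\<phi> (z' \<otimes>\<^bsub>G\<^esub> z)) = w"
        using z z' by (simp add: G.m_assoc G.inv_mult_group)
      then show "(x, w) \<in> twisted_conj G \<phi>"
        using z z' by (auto simp: twisted_conj_def intro!: bexI[of _ "z' \<otimes>\<^bsub>G\<^esub> z"])
    qed
  qed
qed

text \<open>
  Every twisted conjugacy class is a union of cosets of the central subgroup above, so finitely many
  cosets leave room for only finitely many classes.
\<close>

lemma reidemeister_number_finite:
  assumes "group G" "\<phi> \<in> hom G G"
    and fin: "finite ((\<lambda>x. twist_centre G \<phi> #>\<^bsub>G\<^esub> x) ` carrier G)"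
  shows "reidemeister_number G \<phi> \<noteq> \<infinity>"
proof -
  interpret group_hom G G \<phi> by (simp add: assms group_hom_def group_hom_axioms_def)
  interpret D: subgroup "twist_centre G \<phi>" G by (rule twist_centre_subgroup[OF assms(1,2)])
  let ?D = "twist_centre G \<phi>" and ?T = "twisted_conj G \<phi>"
  have rel: "(x, d \<otimes>\<^bsub>G\<^esub> x) \<in> ?T" if "x \<in> carrier G" "d \<in> ?D" for x d
  proof -
    from that(2) obtain z where z: "d \<in> centre G" "z \<in> centre G" "d = z \<otimes>\<^bsub>G\<^esub> inv\<^bsub>G\<^esub> (\<phi> z)"
      by (auto simp: twist_centre_def)
    then have zc: "z \<in> carrier G" "z \<otimes>\<^bsub>G\<^esub> x = x \<otimes>\<^bsub>G\<^esub> z" "d \<otimes>\<^bsub>G\<^esub> x = x \<otimes>\<^bsub>G\<^esub> d" "d \<in> carrier G"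
      using that(1) by (auto intro: centre_closed centre_comm)
    then have "z \<otimes>\<^bsub>G\<^esub> x \<otimes>\<^bsub>G\<^esub> inv\<^bsub>G\<^esub> (\<phi> z) = d \<otimes>\<^bsub>G\<^esub> x"
      using that(1) by (simp add: G.m_assoc z(3))
    then have "\<exists>z\<in>carrier G. z \<otimes>\<^bsub>G\<^esub> x \<otimes>\<^bsub>G\<^esub> inv\<^bsub>G\<^esub> (\<phi> z) = d \<otimes>\<^bsub>G\<^esub> x"
      using zc(1) by blast
    then show ?thesis using zc(4) that(1) by (simp add: twisted_conj_def)
  qed
  have "?T `` {x} = (\<Union>y \<in> ?D #>\<^bsub>G\<^esub> x. ?T `` {y})" if x: "x \<in> carrier G" for x
  proof -
    have "?T `` {y} = ?T `` {x}" if "y \<in> ?D #>\<^bsub>G\<^esub> x" for y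
      using that rel[OF x] equiv_class_eq[OF equiv_twisted_conj[OF assms(1,2)], of x y]
      by (auto simp: r_coset_def)
    moreover have "x \<in> ?D #>\<^bsub>G\<^esub> x" using x by (rule G.rcos_self) (rule D.subgroup_axioms)
    ultimately show ?thesis by blast
  qed
  then have "carrier G // ?T = (\<lambda>C. \<Union>y\<in>C. ?T `` {y}) ` ((\<lambda>x. ?D #>\<^bsub>G\<^esub> x) ` carrier G)"
    by (auto simp: quotient_def image_iff)
  then have "finite (carrier G // ?T)" using fin by simp
  then show ?thesis by (simp add: reidemeister_number_def)
qed

section \<open>The universal property of a presented group\<close>

definition eval_word :: "('b, 'c) monoid_scheme \<Rightarrow> ('g \<Rightarrow> 'b) \<Rightarrow> 'g word \<Rightarrow> 'b" where
  "eval_word H f w = foldr (\<lambda>(x, b) y. (if b then f x else inv\<^bsub>H\<^esub> (f x)) \<otimes>\<^bsub>H\<^esub> y) w \<one>\<^bsub>H\<^esub>"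

lemma eval_word_simps [simp]:
  "eval_word H f [] = \<one>\<^bsub>H\<^esub>"
  "eval_word H f ((x, b) # w) = (if b then f x else inv\<^bsub>H\<^esub> (f x)) \<otimes>\<^bsub>H\<^esub> eval_word H f w"
  by (simp_all add: eval_word_def)

lemma (in group) eval_word_closed:
  assumes "f \<in> S \<rightarrow> carrier G" "w \<in> words S"
  shows "eval_word G f w \<in> carrier G"
  using assms(2) by (induction w) (use assms(1) in \<open>auto simp: Pi_iff\<close>)

lemma (in group) eval_word_append:
  assumes "f \<in> S \<rightarrow> carrier G" "v \<in> words S" "w \<in> words S"
  shows "eval_word G f (v @ w) = eval_word G f v \<otimes> eval_word G f w"
  using assms(2)
proof (induction v)
  case Nil
  then show ?case using eval_word_closed[OF assms(1,3)] by simp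
next
  case (Cons l v)
  then obtain x b where l: "l = (x, b)" "x \<in> S" "v \<in> words S" by (cases l) auto
  then have "f x \<in> carrier G" using assms(1) by auto
  then show ?case using Cons.IH l eval_word_closed[OF assms(1)] assms(3)
    by (auto simp: m_assoc simp del: in_lists_conv_set)
qed

lemma (in group) eval_word_replicate:
  assumes "f x \<in> carrier G"
  shows "eval_word G f (replicate m (x, True)) = f x [^] m"
  by (induction m) (use assms nat_pow_Suc2[OF assms] in simp_all)

lemma eval_word_hom:
  assumes "group G" "group H" "h \<in> hom G H" "f \<in> S \<rightarrow> carrier G" "w \<in> words S"
  shows "h (eval_word G f w) = eval_word H (h \<circ> f) w"
proof -
  interpret group_hom G H h by (simp add: assms group_hom_def group_hom_axioms_def)
  show ?thesis using assms(5)
  proof (induction w)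
    case (Cons l w)
    then obtain x b where l: "l = (x, b)" "x \<in> S" "w \<in> words S" by (cases l) auto
    then have "f x \<in> carrier G" "eval_word G f w \<in> carrier G"
      using assms(4) G.eval_word_closed by auto
    then show ?case using Cons.IH l by simp
  qed simp
qed

abbreviation pres_gen :: "'g set \<Rightarrow> ('g word \<times> 'g word) set \<Rightarrow> 'g \<Rightarrow> 'g word set" where
  "pres_gen S R x \<equiv> pres_rel S R `` {[(x, True)]}"

lemma pres_gen_closed: "x \<in> S \<Longrightarrow> pres_gen S R x \<in> carrier (presented_group S R)"
  by (auto simp: presented_group_carrier intro!: quotientI)

lemma eval_word_pres_gen:
  assumes "w \<in> words S"
  shows "eval_word (presented_group S R) (pres_gen S R) w = pres_rel S R `` {w}"
  using assms
proof (induction w)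
  case Nil
  then show ?case by (simp add: presented_group_one)
next
  case (Cons l w)
  then obtain x b where l: "l = (x, b)" "x \<in> S" "w \<in> words S" by (cases l) auto
  interpret group "presented_group S R" by (rule group_presented_group)
  have cl: "pres_rel S R `` {[(x, c)]} \<in> carrier (presented_group S R)" for c
    using l by (auto simp: presented_group_carrier intro!: quotientI)
  have "pres_rel S R `` {[(x, False)]} \<otimes>\<^bsub>presented_group S R\<^esub> pres_gen S R x
      = \<one>\<^bsub>presented_group S R\<^esub>"
    using l pres_rel.cancel[of x S False R]
    by (simp add: presented_group_mult presented_group_one equiv_class_eq[OF equiv_pres_rel])
  then have "inv\<^bsub>presented_group S R\<^esub> (pres_gen S R x) = pres_rel S R `` {[(x, False)]}"
    by (intro inv_equality cl)
  then show ?case using Cons.IH l by (auto simp: presented_group_mult simp del: in_lists_conv_set)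
qed

lemma pres_gen_relation:
  assumes "(u, v) \<in> R" "u \<in> words S" "v \<in> words S"
  shows "eval_word (presented_group S R) (pres_gen S R) u
       = eval_word (presented_group S R) (pres_gen S R) v"
  using assms equiv_class_eq[OF equiv_pres_rel pres_rel.relation[OF assms]]
  by (simp add: eval_word_pres_gen)

lemma presented_group_generate:
  "carrier (presented_group S R) = generate (presented_group S R) (pres_gen S R ` S)"
proof
  interpret group "presented_group S R" by (rule group_presented_group)
  have *: "pres_gen S R ` S \<subseteq> carrier (presented_group S R)"
    by (rule image_subsetI) (rule pres_gen_closed)
  show "generate (presented_group S R) (pres_gen S R ` S) \<subseteq> carrier (presented_group S R)"
    using generate_incl[OF *] .
  have "eval_word (presented_group S R) (pres_gen S R) w
      \<in> generate (presented_group S R) (pres_gen S R ` S)" if "w \<in> words S" for w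
    using that
    by (induction w)
      (auto intro!: generate.one generate.eng generate.incl[OF imageI] generate.inv[OF imageI])
  then show "carrier (presented_group S R) \<subseteq> generate (presented_group S R) (pres_gen S R ` S)"
    by (auto simp: presented_group_carrier quotient_def eval_word_pres_gen
        simp del: in_lists_conv_set)
qed

text \<open>
  Evaluation of words respects the defining relations, hence the whole congruence that they
  generate, and so descends to the classes.
\<close>

lemma presented_group_lift:
  assumes "group H" and f: "f \<in> S \<rightarrow> carrier H"
    and rels: "\<And>u v. (u, v) \<in> R \<Longrightarrow> eval_word H f u = eval_word H f v"
  obtains h where "h \<in> hom (presented_group S R) H" "\<And>x. x \<in> S \<Longrightarrow> h (pres_gen S R x) = f x"
proof -
  interpret H: group H by fact
  have resp: "eval_word H f u = eval_word H f v" if "(u, v) \<in> pres_rel S R" for u v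
    using that
  proof induction
    case (cancel x b)
    then have "f x \<in> carrier H" using f by auto
    then show ?case by auto
  next
    case (cong u u' v v')
    then show ?case
      using pres_rel_words[of u u'] pres_rel_words[of v v'] by (simp add: H.eval_word_append[OF f])
  qed (use rels in auto)
  define h where "h U = the_elem (eval_word H f ` U)" for U
  have h: "h (pres_rel S R `` {w}) = eval_word H f w" if "w \<in> words S" for w
  proof -
    have "eval_word H f ` (pres_rel S R `` {w}) = {eval_word H f w}"
      using resp[of w] pres_rel.refl[OF that] by (auto simp: image_iff)
    then show ?thesis by (simp add: h_def)
  qed
  show ?thesis
  proof
    show "h \<in> hom (presented_group S R) H"
    proof (rule homI)
      fix U V assume "U \<in> carrier (presented_group S R)" "V \<in> carrier (presented_group S R)"
      then obtain u v where "u \<in> words S" "v \<in> words S"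
        "U = pres_rel S R `` {u}" "V = pres_rel S R `` {v}"
        unfolding presented_group_carrier by (elim quotientE) blast
      then show "h (U \<otimes>\<^bsub>presented_group S R\<^esub> V) = h U \<otimes>\<^bsub>H\<^esub> h V"
        by (simp add: presented_group_mult h H.eval_word_append[OF f] del: in_lists_conv_set)
    next
      fix U assume "U \<in> carrier (presented_group S R)"
      then obtain u where "u \<in> words S" "U = pres_rel S R `` {u}"
        unfolding presented_group_carrier by (elim quotientE) blast
      then show "h U \<in> carrier H" using H.eval_word_closed[OF f] h by simp
    qed
    fix x assume "x \<in> S"
    moreover from this have "f x \<in> carrier H" using f by auto
    ultimately show "h (pres_gen S R x) = f x" by (simp add: h)
  qed
qed

section \<open>The lower central series under homomorphisms\<close>

lemma hom_commutator_subgroup: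
  assumes "group G" "group H" "h \<in> hom G H" "A \<subseteq> carrier G" "B \<subseteq> carrier G"
  shows "h ` commutator_subgroup G A B = commutator_subgroup H (h ` A) (h ` B)"
proof -
  interpret group_hom G H h by (simp add: assms group_hom_def group_hom_axioms_def)
  let ?C = "\<Union>x\<in>A. \<Union>y\<in>B. {x \<otimes>\<^bsub>G\<^esub> y \<otimes>\<^bsub>G\<^esub> inv\<^bsub>G\<^esub> x \<otimes>\<^bsub>G\<^esub> inv\<^bsub>G\<^esub> y}"
  have C: "?C \<subseteq> carrier G" using assms(4,5) by blast
  have eq: "h (x \<otimes>\<^bsub>G\<^esub> y \<otimes>\<^bsub>G\<^esub> inv\<^bsub>G\<^esub> x \<otimes>\<^bsub>G\<^esub> inv\<^bsub>G\<^esub> y)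
      = h x \<otimes>\<^bsub>H\<^esub> h y \<otimes>\<^bsub>H\<^esub> inv\<^bsub>H\<^esub> h x \<otimes>\<^bsub>H\<^esub> inv\<^bsub>H\<^esub> h y" if "x \<in> A" "y \<in> B" for x y
    using that assms(4,5) by (auto simp: subset_iff)
  have "h ` ?C = (\<Union>x\<in>h ` A. \<Union>y\<in>h ` B. {x \<otimes>\<^bsub>H\<^esub> y \<otimes>\<^bsub>H\<^esub> inv\<^bsub>H\<^esub> x \<otimes>\<^bsub>H\<^esub> inv\<^bsub>H\<^esub> y})"
    by (simp add: image_UN eq)
  then show ?thesis
    unfolding commutator_subgroup_def using generate_img[OF C] by simp
qed

lemma lower_central_subset: "group G \<Longrightarrow> lower_central G c \<subseteq> carrier G"
  using group.lower_central_normal normal_imp_subgroup subgroup.subset by blast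

lemma commutator_subgroup_mono:
  assumes "group G" "A \<subseteq> A'" "B \<subseteq> B'" 
  shows "commutator_subgroup G A B \<subseteq> commutator_subgroup G A' B'"
  unfolding commutator_subgroup_def
  by (intro group.mono_generate[OF assms(1)]) (use assms(2,3) in blast)

lemma hom_lower_central:
  assumes "group G" "group H" "h \<in> hom G H"
  shows "h ` lower_central G c \<subseteq> lower_central H c"
proof (induction c)
  case 0
  then show ?case using hom_in_carrier[OF assms(3)] by auto
next
  case (Suc c)
  have "h ` carrier G \<subseteq> carrier H" using hom_in_carrier[OF assms(3)] by blast
  with Suc show ?case
    by (cases c) (simp_all add: commutator_subgroup_mono[OF assms(2)]
        hom_commutator_subgroup[OF assms lower_central_subset[OF assms(1)]])
qed

lemma epi_lower_central:
  assumes "group G" "group H" "h \<in> hom G H" "h ` carrier G = carrier H"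
  shows "lower_central H c = h ` lower_central G c"
proof (induction c)
  case 0
  then show ?case using assms(4) by simp
next
  case (Suc c)
  then show ?case
    by (cases c) (simp_all add: assms(4)
        hom_commutator_subgroup[OF assms(1-3) lower_central_subset[OF assms(1)]])
qed

section \<open>Baumslag-Solitar groups in which \<open>a\<close> is torsion\<close>

text \<open>
  This is what the argument uses of the nilpotent quotients: the generator \<open>a\<close> has finite order, a
  common power \<open>k\<close> of the \<open>t p\<close> centralises \<open>a\<close>, and the universal property holds for maps into the
  group itself that fix \<open>a\<close>. Asking for maps into other groups would exclude the nilpotent
  quotients, which satisfy more relations than those between \<open>a\<close> and the \<open>t p\<close> listed here.
\<close>

locale torsion_gsbs = group G for G (structure) +
  fixes P :: "'i set" and q :: "'i \<Rightarrow> nat" and a :: 'a and t :: "'i \<Rightarrow> 'a" and k :: nat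
  assumes finite_P: "finite P"
    and a_closed [simp]: "a \<in> carrier G"
    and t_closed [simp]: "p \<in> P \<Longrightarrow> t p \<in> carrier G"
    and t_comm: "p \<in> P \<Longrightarrow> s \<in> P \<Longrightarrow> t p \<otimes> t s = t s \<otimes> t p"
    and t_a: "p \<in> P \<Longrightarrow> t p \<otimes> a \<otimes> inv (t p) = a [^] q p"
    and a_torsion: "\<exists>m>0. a [^] (m::nat) = \<one>"
    and k_pos: "k > 0"
    and t_pow_a: "p \<in> P \<Longrightarrow> t p [^] k \<otimes> a = a \<otimes> t p [^] k"
    and generated: "carrier G = generate G (insert a (t ` P))"
    and lift: "\<lbrakk>\<tau> \<in> P \<rightarrow> carrier G;
        \<And>p s. p \<in> P \<Longrightarrow> s \<in> P \<Longrightarrow> \<tau> p \<otimes> \<tau> s = \<tau> s \<otimes> \<tau> p;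
        \<And>p. p \<in> P \<Longrightarrow> \<tau> p \<otimes> a \<otimes> inv (\<tau> p) = a [^] q p\<rbrakk>
      \<Longrightarrow> \<exists>\<phi>\<in>hom G G. \<phi> a = a \<and> (\<forall>p\<in>P. \<phi> (t p) = \<tau> p)"
begin

lemma gens_closed: "insert a (t ` P) \<subseteq> carrier G" by auto

lemma centreI:
  assumes z: "z \<in> carrier G" and "z \<otimes> a = a \<otimes> z" "\<And>p. p \<in> P \<Longrightarrow> z \<otimes> t p = t p \<otimes> z"
  shows "z \<in> centre G"
proof -
  have gen: "g \<otimes> z = z \<otimes> g" "g \<in> carrier G" if "g \<in> insert a (t ` P)" for g
    using that assms by auto
  have "z \<otimes> x = x \<otimes> z" if "x \<in> carrier G" for x
  proof -
    have "x \<in> {x \<in> carrier G. z \<otimes> x = x \<otimes> z}"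
      using gens_closed _ that[unfolded generated]
    proof (rule generate_induct_left)
      fix g v assume g: "g \<in> insert a (t ` P)" and v: "v \<in> {x \<in> carrier G. z \<otimes> x = x \<otimes> z}"
      have step: "h \<otimes> v \<in> {x \<in> carrier G. z \<otimes> x = x \<otimes> z}"
        if h: "h \<in> carrier G" "h \<otimes> z = z \<otimes> h" for h
      proof -
        have v': "v \<in> carrier G" "z \<otimes> v = v \<otimes> z" using v by auto
        have "z \<otimes> (h \<otimes> v) = h \<otimes> (z \<otimes> v)"
          using z h v'(1) by (simp add: m_assoc[symmetric])
        also have "\<dots> = h \<otimes> v \<otimes> z" using z h(1) v' by (simp add: m_assoc)
        finally show ?thesis using h v by simp
      qed
      show "g \<otimes> v \<in> {x \<in> carrier G. z \<otimes> x = x \<otimes> z}" using step gen[OF g] by blast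
      show "inv g \<otimes> v \<in> {x \<in> carrier G. z \<otimes> x = x \<otimes> z}"
        using gen[OF g] z by (intro step inv_closed inv_commute)
    qed (use z in auto)
    then show ?thesis by simp
  qed
  then show ?thesis using z by (simp add: centre_def)
qed

lemma t_pow_centre:
  assumes "p \<in> P"
  shows "t p [^] (int k * m) \<in> centre G"
proof -
  have "t p [^] int k \<in> centre G"
  proof (rule centreI)
    show "t p [^] int k \<otimes> t s = t s \<otimes> t p [^] int k" if "s \<in> P" for s
      using assms that t_comm by (intro int_pow_commute) auto
  qed (use assms t_pow_a in \<open>auto simp: int_pow_int\<close>)
  then have "(t p [^] int k) [^] m \<in> centre G"
    by (rule int_pow_closed_subgroup[OF centre_subgroup])
  then show ?thesis using assms by (simp add: int_pow_pow)
qed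

lemma hom_eqI:
  assumes "\<phi> \<in> hom G G" "\<psi> \<in> hom G G" "\<phi> a = \<psi> a" "\<And>p. p \<in> P \<Longrightarrow> \<phi> (t p) = \<psi> (t p)"
    and "x \<in> carrier G"
  shows "\<phi> x = \<psi> x"
  using assms(5)[unfolded generated]
  by (rule hom_eq_on_generate[OF group_axioms group_axioms assms(1,2) gens_closed, rotated])
    (use assms(3,4) in auto)

text \<open>
  Multiplying \<open>t p\<close> by a central element disturbs neither the commutation relations nor the action
  of \<open>t p\<close> on \<open>a\<close>.
\<close>

lemma transvection_hom:
  assumes p: "p \<in> P" and s: "s \<in> P"
  shows "\<exists>\<phi>\<in>hom G G. \<phi> a = a \<and> \<phi> (t p) = t p \<otimes> t s [^] (int k * m)
    \<and> (\<forall>x\<in>P - {p}. \<phi> (t x) = t x)"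
proof -
  define w where "w x = (if x = p then t s [^] (int k * m) else \<one>)" for x
  have w: "w x \<in> centre G" for x
    using t_pow_centre[OF s] subgroup.one_closed[OF centre_subgroup] by (simp add: w_def)
  note [simp] = centre_closed[OF w]
  have "\<exists>\<phi>\<in>hom G G. \<phi> a = a \<and> (\<forall>x\<in>P. \<phi> (t x) = t x \<otimes> w x)"
  proof (rule lift)
    fix x y assume x: "x \<in> P" and y: "y \<in> P"
    have *: "t x \<otimes> w x \<otimes> (t y \<otimes> w y) = (t x \<otimes> t y) \<otimes> (w x \<otimes> w y)" if "x \<in> P" "y \<in> P" for x y
    proof -
      have "t x \<otimes> w x \<otimes> (t y \<otimes> w y) = t x \<otimes> (w x \<otimes> t y) \<otimes> w y"
        using that by (simp add: m_assoc)
      also have "\<dots> = t x \<otimes> (t y \<otimes> w x) \<otimes> w y"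
        using that centre_comm[OF w, of "t y" x] by simp
      finally show ?thesis using that by (simp add: m_assoc)
    qed
    show "t x \<otimes> w x \<otimes> (t y \<otimes> w y) = t y \<otimes> w y \<otimes> (t x \<otimes> w x)"
      using x y *[OF x y] *[OF y x] t_comm[OF x y] centre_comm[OF w, of "w y" x] by simp
  next
    fix x assume x: "x \<in> P"
    have "t x \<otimes> w x \<otimes> a \<otimes> inv (t x \<otimes> w x) = t x \<otimes> (w x \<otimes> a) \<otimes> inv (w x) \<otimes> inv (t x)"
      using x by (simp add: m_assoc inv_mult_group)
    also have "\<dots> = t x \<otimes> (a \<otimes> w x) \<otimes> inv (w x) \<otimes> inv (t x)"
      using centre_comm[OF w, of a x] by simp
    also have "\<dots> = t x \<otimes> a \<otimes> inv (t x)" using x by (simp add: m_assoc)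
    finally show "t x \<otimes> w x \<otimes> a \<otimes> inv (t x \<otimes> w x) = a [^] q x" using t_a[OF x] by simp
  qed auto
  then obtain \<phi> where "\<phi> \<in> hom G G" "\<phi> a = a" "\<And>x. x \<in> P \<Longrightarrow> \<phi> (t x) = t x \<otimes> w x" by blast
  then show ?thesis using p by (intro bexI[of _ \<phi>]) (auto simp: w_def)
qed

text \<open>
  For \<open>p \<noteq> s\<close> the factor \<open>t s [^] (int k * m)\<close> is itself fixed, so the transvection for \<open>- m\<close> undoes
  the one for \<open>m\<close>. This is where two distinct primes are indispensable.
\<close>

lemma transvection_iso:
  assumes p: "p \<in> P" and s: "s \<in> P" and "p \<noteq> s"
  shows "\<exists>\<phi>\<in>iso G G. \<phi> a = a \<and> \<phi> (t p) = t p \<otimes> t s [^] (int k * m)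
    \<and> (\<forall>x\<in>P - {p}. \<phi> (t x) = t x)"
proof -
  obtain F where F: "F j \<in> hom G G" "F j a = a" "F j (t p) = t p \<otimes> t s [^] (int k * j)"
    "\<And>x. x \<in> P - {p} \<Longrightarrow> F j (t x) = t x" for j
    using transvection_hom[OF p s] by metis
  have inverse: "F (- j) (F j x) = x" if "x \<in> carrier G" for j x
  proof -
    interpret F: group_hom G G "F (- j)"
      using F(1) by (simp add: group_hom_def group_hom_axioms_def)
    have "(F (- j) \<circ> F j) x = id x"
    proof (rule hom_eqI[OF _ _ _ _ that])
      show "F (- j) \<circ> F j \<in> hom G G" using Group.hom_compose[OF F(1) F(1)] .
      show "id \<in> hom G G" by (auto simp: hom_def)
      show "(F (- j) \<circ> F j) a = id a" by (simp add: F)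
      fix x assume x: "x \<in> P"
      show "(F (- j) \<circ> F j) (t x) = id (t x)"
      proof (cases "x = p")
        case True
        have "F (- j) (t s [^] (int k * j)) = t s [^] (int k * j)"
          using s \<open>p \<noteq> s\<close> by (simp add: F.hom_int_pow F(4))
        then show ?thesis using True p s
          by (simp add: F m_assoc int_pow_mult[symmetric])
      qed (use x in \<open>simp add: F\<close>)
    qed
    then show ?thesis by simp
  qed
  have "F m \<in> iso G G"
    using inverse[of _ m] inverse[of _ "- m"] by (intro inverse_homs_iso[of _ _ "F (- m)"] F(1)) auto
  then show ?thesis using F by blast
qed

text \<open>
  The transvections are composed with the highest index applied first, so that no factor
  \<open>t (f (Suc i))\<close> introduced by one of them is changed by a later one.
\<close>

lemma chain_iso:
  assumes f: "f ` {..<r} \<subseteq> P" "inj_on f {..<r}" and "j < r"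
  shows "\<exists>\<phi>\<in>iso G G. \<phi> a = a \<and> (\<forall>i<j. \<phi> (t (f i)) = t (f i) \<otimes> t (f (Suc i)) [^] int k)
    \<and> (\<forall>i. j \<le> i \<and> i < r \<longrightarrow> \<phi> (t (f i)) = t (f i))"
  using \<open>j < r\<close>
proof (induction j)
  case 0
  show ?case by (rule bexI[of _ id]) (auto simp: iso_def hom_def)
next
  case (Suc j)
  then obtain S where S: "S \<in> iso G G" "S a = a"
    "\<And>i. i < j \<Longrightarrow> S (t (f i)) = t (f i) \<otimes> t (f (Suc i)) [^] int k"
    "\<And>i. j \<le> i \<Longrightarrow> i < r \<Longrightarrow> S (t (f i)) = t (f i)"
    by auto
  have inj: "f i = f i' \<longleftrightarrow> i = i'" if "i < r" "i' < r" for i i'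
    using f(2) that by (auto simp: inj_on_def)
  have fP: "f i \<in> P" if "i < r" for i using f(1) that by auto
  obtain T where T: "T \<in> iso G G" "T a = a"
    "T (t (f j)) = t (f j) \<otimes> t (f (Suc j)) [^] int k"
    "\<And>x. x \<in> P - {f j} \<Longrightarrow> T (t x) = t x"
    using transvection_iso[of "f j" "f (Suc j)" 1] Suc.prems fP inj by auto
  interpret S: group_hom G G S
    using S(1) by (simp add: group_hom_def group_hom_axioms_def iso_def)
  show ?case
  proof (intro bexI conjI allI impI)
    show "S \<circ> T \<in> iso G G" using iso_set_trans[OF T(1) S(1)] .
    show "(S \<circ> T) a = a" by (simp add: S T)
    fix i assume i: "i < Suc j"
    show "(S \<circ> T) (t (f i)) = t (f i) \<otimes> t (f (Suc i)) [^] int k"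
    proof (cases "i = j")
      case True
      then show ?thesis using Suc.prems fP S(4) T(3) by (simp add: S.hom_int_pow)
    next
      case False
      then show ?thesis using i Suc.prems fP inj S(3) T(4) by (simp add: compose_eq)
    qed
  next
    fix i assume i: "Suc j \<le> i \<and> i < r"
    then show "(S \<circ> T) (t (f i)) = t (f i)"
      using Suc.prems fP inj S(4) T(4) by (simp add: compose_eq)
  qed
qed

text \<open>
  The cyclic group of \<open>a\<close> is normalised by \<open>t p\<close>. The relation gives this for nonnegative powers of
  \<open>t p\<close>; a negative power agrees with a nonnegative one up to a central factor \<open>t p [^] (int k * j)\<close>.
\<close>

lemma a_pow_t_pow:
  assumes p: "p \<in> P"
  shows "\<exists>e'::int. a [^] (e::int) \<otimes> t p [^] (i::int) = t p [^] i \<otimes> a [^] e'"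
proof -
  have nat: "\<exists>e'::int. t p [^] (n::nat) \<otimes> a [^] e = a [^] e' \<otimes> t p [^] n" for n and e :: int
  proof (induction n arbitrary: e)
    case 0
    show ?case by (intro exI[of _ e]) simp
  next
    case (Suc n)
    have "t p \<otimes> a [^] e \<otimes> inv (t p) = a [^] (int (q p) * e)"
      using p by (simp add: int_pow_conjugate t_a flip: int_pow_int int_pow_pow)
    then have "t p \<otimes> a [^] e = a [^] (int (q p) * e) \<otimes> t p"
      using p by (metis a_closed int_pow_closed inv_solve_right m_closed t_closed)
    then have "t p [^] Suc n \<otimes> a [^] e = t p [^] n \<otimes> a [^] (int (q p) * e) \<otimes> t p"
      using p by (simp add: m_assoc)
    moreover obtain e' :: int where "t p [^] n \<otimes> a [^] (int (q p) * e) = a [^] e' \<otimes> t p [^] n"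
      using Suc by blast
    ultimately have "t p [^] Suc n \<otimes> a [^] e = a [^] e' \<otimes> t p [^] Suc n"
      using p by (simp add: m_assoc)
    then show ?case by blast
  qed
  \<comment> \<open>\<open>t p [^] (- i)\<close> is the central element \<open>c\<close> times a power with exponent in \<open>{0..<k}\<close>\<close>
  define n where "n = nat ((- i) mod int k)"
  define c where "c = t p [^] (int k * ((- i) div int k))"
  have "- i = int k * ((- i) div int k) + int n"
    using k_pos by (simp add: n_def)
  then have i: "t p [^] (- i) = c \<otimes> t p [^] n"
    unfolding c_def using p by (metis int_pow_int int_pow_mult t_closed)
  have c: "c \<in> centre G" unfolding c_def using p by (rule t_pow_centre)
  obtain e' :: int where e': "t p [^] n \<otimes> a [^] e = a [^] e' \<otimes> t p [^] n" using nat by blast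
  have "t p [^] (- i) \<otimes> a [^] e = c \<otimes> a [^] e' \<otimes> t p [^] n"
    using e' p centre_closed[OF c] by (simp add: i m_assoc)
  also have "\<dots> = a [^] e' \<otimes> t p [^] (- i)"
    using p centre_closed[OF c] centre_comm[OF c, of "a [^] e'"] by (simp add: i m_assoc)
  finally have "a [^] e \<otimes> t p [^] i = t p [^] i \<otimes> a [^] e'"
    using p by (intro inv_swap) (simp_all add: int_pow_neg)
  then show ?thesis by blast
qed

text \<open>
  Every element has the normal form \<open>t\<^sub>1\<^bsup>i\<^sub>1\<^esup> \<dots> t\<^sub>r\<^bsup>i\<^sub>r\<^esup> a\<^bsup>e\<^esup>\<close>; modulo \<open>D\<close> each exponent of a \<open>t p\<close> matters
  only modulo \<open>N\<close>, and \<open>e\<close> only modulo the order of \<open>a\<close>. In the induction over sets of primes,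
  \<open>W\<close> is the set of normal forms that involve only the primes of \<open>X\<close>.
\<close>

lemma finite_mod_central:
  assumes D: "subgroup D G" "D \<subseteq> centre G" and N: "N > 0" "\<And>p. p \<in> P \<Longrightarrow> t p [^] int N \<in> D"
  shows "finite ((\<lambda>x. D #> x) ` carrier G)"
proof -
  interpret D: normal D G using D by (rule central_normal)
  have "\<exists>W\<subseteq>carrier G. \<one> \<in> W \<and> (\<forall>w\<in>W. \<forall>e::int. a [^] e \<otimes> w \<in> W)
      \<and> (\<forall>p\<in>X. \<forall>w\<in>W. \<forall>i::int. t p [^] i \<otimes> w \<in> W) \<and> finite ((\<lambda>x. D #> x) ` W)"
    if "finite X" "X \<subseteq> P" for X
    using that
  proof (induction rule: finite_induct)
    case empty
    obtain m where m: "m > 0" "a [^] (m::nat) = \<one>" using a_torsion by blast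
    have "a [^] e = a [^] (e mod int m)" for e :: int
    proof -
      have "a [^] e = a [^] (int m * (e div int m) + e mod int m)" by simp
      also have "\<dots> = (a [^] int m) [^] (e div int m) \<otimes> a [^] (e mod int m)"
        by (simp only: int_pow_mult int_pow_pow a_closed)
      also have "\<dots> = a [^] (e mod int m)" using m by (simp add: int_pow_int)
      finally show ?thesis .
    qed
    then have "range (\<lambda>e::int. a [^] e) \<subseteq> (\<lambda>e::int. a [^] e) ` {0..<int m}"
      using m(1) by (auto intro!: image_eqI[where x = "_ mod int m"])
    then have "finite (range (\<lambda>e::int. a [^] e))" by (rule finite_subset) simp
    then show ?case
      by (intro exI[of _ "range (\<lambda>e::int. a [^] e)"])
        (auto simp: int_pow_mult[symmetric] intro: range_eqI[of _ _ 0])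
  next
    case (insert p X)
    then have p: "p \<in> P" by simp
    from insert.IH insert.prems obtain W where W: "W \<subseteq> carrier G" "\<one> \<in> W"
      "\<forall>w\<in>W. \<forall>e::int. a [^] e \<otimes> w \<in> W" "\<forall>x\<in>X. \<forall>w\<in>W. \<forall>i::int. t x [^] i \<otimes> w \<in> W"
      and fin: "finite ((\<lambda>x. D #> x) ` W)"
      by auto
    have Wc: "w \<in> carrier G" if "w \<in> W" for w using W(1) that by blast
    define V where "V = (\<Union>i::int. (\<lambda>w. t p [^] i \<otimes> w) ` W)"
    have VI: "t p [^] (i::int) \<otimes> w \<in> V" if "w \<in> W" for i w
      using that by (auto simp: V_def)
    have V1: "V \<subseteq> carrier G" using p Wc by (auto simp: V_def)
    have V2: "\<one> \<in> V" using VI[OF W(2), of 0] by simp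
    have V3: "a [^] e \<otimes> v \<in> V" if "v \<in> V" for v and e :: int
    proof -
      obtain i :: int and w where w: "w \<in> W" "v = t p [^] i \<otimes> w" using \<open>v \<in> V\<close> by (auto simp: V_def)
      obtain e' :: int where e': "a [^] e \<otimes> t p [^] i = t p [^] i \<otimes> a [^] e'"
        using a_pow_t_pow[OF p] by blast
      have "a [^] e \<otimes> v = (a [^] e \<otimes> t p [^] i) \<otimes> w" using p w Wc by (simp add: m_assoc)
      also have "\<dots> = t p [^] i \<otimes> (a [^] e' \<otimes> w)" using p w Wc by (simp add: e' m_assoc)
      finally show ?thesis using VI W(3) w(1) by simp
    qed
    have V4: "t x [^] j \<otimes> v \<in> V" if x: "x \<in> insert p X" and "v \<in> V" for x v and j :: int
    proof -
      obtain i :: int and w where w: "w \<in> W" "v = t p [^] i \<otimes> w" using \<open>v \<in> V\<close> by (auto simp: V_def)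
      have xP: "x \<in> P" using x insert.prems by auto
      show ?thesis
      proof (cases "x = p")
        case True
        then have "t x [^] j \<otimes> v = t p [^] (j + i) \<otimes> w"
          using p w Wc by (simp add: int_pow_mult m_assoc)
        then show ?thesis using VI w(1) by simp
      next
        case False
        have "t x [^] j \<otimes> t p [^] i = t p [^] i \<otimes> t x [^] j"
          using xP p t_comm by (intro int_pow_commute) (auto intro!: int_pow_commute[symmetric])
        then have "t x [^] j \<otimes> v = t p [^] i \<otimes> (t x [^] j \<otimes> w)"
          using xP p w Wc by (simp add: m_assoc[symmetric])
        then show ?thesis using VI W(4) w(1) x False by simp
      qed
    qed
    have V5: "finite ((\<lambda>x. D #> x) ` V)"
    proof (rule finite_subset)
      have "D #> (t p [^] i \<otimes> w) = (D #> t p [^] (i mod int N)) <#> (D #> w)"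
        if w: "w \<in> W" for w and i :: int
      proof -
        have d: "t p [^] (int N * (i div int N)) \<in> D"
          using int_pow_closed_subgroup[OF D(1) N(2)[OF p], of "i div int N"] p
          by (simp add: int_pow_pow)
        have "t p [^] i = t p [^] (int N * (i div int N)) \<otimes> t p [^] (i mod int N)"
          using p by (simp flip: int_pow_mult)
        then have "D #> t p [^] i = D #> t p [^] (i mod int N)"
          using p d D.subset by (simp add: coset_mult_assoc[symmetric] D.rcos_const coset_join2 D.subgroup_axioms)
        then show ?thesis using p Wc[OF w] by (simp flip: D.rcos_sum)
      qed
      then show "(\<lambda>x. D #> x) ` V
          \<subseteq> (\<Union>b\<in>{0..<int N}. (\<lambda>C. (D #> t p [^] b) <#> C) ` (\<lambda>x. D #> x) ` W)"
        using N(1) by (fastforce simp: V_def)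
      show "finite (\<Union>b\<in>{0..<int N}. (\<lambda>C. (D #> t p [^] b) <#> C) ` (\<lambda>x. D #> x) ` W)"
        using fin by blast
    qed
    show ?case using V1 V2 V3 V4 V5 by (intro exI[of _ V]) simp
  qed
  from this[OF finite_P order_refl] obtain W where W: "W \<subseteq> carrier G" "\<one> \<in> W"
    "\<forall>w\<in>W. \<forall>e::int. a [^] e \<otimes> w \<in> W" "\<forall>x\<in>P. \<forall>w\<in>W. \<forall>i::int. t x [^] i \<otimes> w \<in> W"
    and fin: "finite ((\<lambda>x. D #> x) ` W)"
    by auto
  have "x \<in> W" if "x \<in> generate G (insert a (t ` P))" for x
    using gens_closed W(1) that W(2)
  proof (rule generate_induct_left)
    fix g v assume g: "g \<in> insert a (t ` P)" and v: "v \<in> W"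
    have "g [^] (i::int) \<otimes> v \<in> W" for i using g v W(3,4) by auto
    from this[of 1] this[of "- 1"] show "g \<otimes> v \<in> W" "inv g \<otimes> v \<in> W"
      using g gens_closed by (auto simp: int_pow_neg subset_iff)
  qed
  then show ?thesis using fin generated W(1) by (metis subset_antisym subsetI)
qed

text \<open>
  With \<open>z = x\<^bsup>-k\<^esup>\<close> one gets \<open>z \<phi>(z)\<inverse> = x\<^bsup>-k\<^esup> (x y)\<^bsup>k\<^esup> = y\<^bsup>k\<^esup>\<close>.
\<close>

lemma pow_mem_twist_centre:
  assumes \<phi>: "\<phi> \<in> hom G G" and xy: "x \<in> carrier G" "y \<in> carrier G" "x \<otimes> y = y \<otimes> x"
    and "\<phi> x = x \<otimes> y" and "x [^] int k \<in> centre G" "y [^] int k \<in> centre G"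
  shows "y [^] int k \<in> twist_centre G \<phi>"
proof -
  interpret \<phi>: group_hom G G \<phi>
    using \<phi> by (simp add: group_hom_def group_hom_axioms_def)
  let ?z = "inv (x [^] int k)"
  have "inv (\<phi> ?z) = x [^] int k \<otimes> y [^] int k"
    using xy(1,2) by (simp add: \<phi>.hom_int_pow assms(5) int_pow_mult_distrib[OF xy(3,1,2)])
  then have "y [^] int k = ?z \<otimes> inv (\<phi> ?z)"
    using xy(1,2) by (simp add: m_assoc[symmetric])
  moreover have "?z \<in> centre G"
    using assms(6) subgroup.m_inv_closed[OF centre_subgroup] by blast
  ultimately show ?thesis using assms(7) unfolding twist_centre_def by blast
qed

text \<open>
  On exponent vectors the automorphism \<open>\<phi>\<close> below sends \<open>e\<^sub>i\<close> to \<open>e\<^sub>i + k e\<^sub>i\<^sub>+\<^sub>1\<close> for \<open>i < r\<close> and \<open>e\<^sub>r\<close> to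
  \<open>e\<^sub>r - k e\<^sub>0 - k\<^sup>2 e\<^sub>1\<close>. With \<open>e\<^sub>i = x\<^bsup>i\<^esup>\<close> this is multiplication by \<open>1 + k x\<close> on
  \<open>\<int>[x] / (x\<^bsup>r+1\<^esup> + k x + 1)\<close>. There \<open>1 + k x = - x\<^bsup>r+1\<^esup>\<close> and \<open>x\<close> are units, so \<open>\<phi>\<close> is invertible while
  \<open>\<phi> - 1\<close>, multiplication by \<open>k x\<close>, has the finite cokernel \<open>(\<int>/k)\<^bsup>r+1\<^esup>\<close>. Applying \<open>\<phi> - 1\<close> to
  the multiples of \<open>k\<close>, which are central, puts every \<open>k\<^sup>2 e\<^sub>i\<close> into the central subgroup of the criterion.
\<close>

lemma not_R_infinity:
  assumes "card P \<ge> 2"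
  shows "\<not> has_R_infinity G"
proof -
  define r where "r = card P - 1"
  have r: "card P = Suc r" "0 < r" using assms by (auto simp: r_def)
  obtain f where "bij_betw f {0..<Suc r} P"
    using ex_bij_betw_nat_finite[OF finite_P] r(1) by auto
  then have f: "f ` {..<Suc r} = P" "inj_on f {..<Suc r}"
    by (auto simp: bij_betw_def atLeast0LessThan)
  define u where "u i = t (f i)" for i
  have fP: "f i \<in> P" if "i \<le> r" for i using f(1) that by auto
  have inj: "f i = f j \<longleftrightarrow> i = j" if "i \<le> r" "j \<le> r" for i j
    using f(2) that by (auto simp: inj_on_def less_Suc_eq_le)
  have u [simp]: "u i \<in> carrier G" if "i \<le> r" for i using fP[OF that] by (simp add: u_def)
  have u_comm: "u i [^] (x::int) \<otimes> u j [^] (y::int) = u j [^] y \<otimes> u i [^] x" if "i \<le> r" "j \<le> r" for i j x y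
    using that fP t_comm
    by (intro int_pow_commute) (auto simp: u_def intro!: int_pow_commute[symmetric])
  have u_centre: "u i [^] (int k * m) \<in> centre G" if "i \<le> r" for i m
    unfolding u_def using fP[OF that] by (rule t_pow_centre)
  obtain S where S: "S \<in> iso G G" "\<And>i. i < r \<Longrightarrow> S (u i) = u i \<otimes> u (Suc i) [^] int k"
    "S (u r) = u r"
    using chain_iso[of f "Suc r" r] f by (auto simp: u_def)
  obtain T where T: "T \<in> iso G G" "T (u r) = u r \<otimes> u 0 [^] (- int k)" "\<And>i. i < r \<Longrightarrow> T (u i) = u i"
    using transvection_iso[of "f r" "f 0" "- 1"] fP inj r(2) by (auto simp: u_def)
  interpret S: group_hom G G S
    using S(1) by (simp add: group_hom_def group_hom_axioms_def iso_def)
  define \<phi> where "\<phi> = S \<circ> T"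
  have \<phi>: "\<phi> \<in> iso G G" unfolding \<phi>_def using iso_set_trans[OF T(1) S(1)] .
  then have \<phi>_hom: "\<phi> \<in> hom G G" by (simp add: iso_def)
  define D where "D = twist_centre G \<phi>"
  have D: "subgroup D G" unfolding D_def by (intro twist_centre_subgroup group_axioms \<phi>_hom)
  interpret D: subgroup D G by fact
  have Suc_mem: "u (Suc i) [^] int (k * k) \<in> D" if i: "i < r" for i
  proof -
    have "(u (Suc i) [^] int k) [^] int k \<in> D"
      unfolding D_def
    proof (rule pow_mem_twist_centre[OF \<phi>_hom])
      show "\<phi> (u i) = u i \<otimes> u (Suc i) [^] int k" using i by (simp add: \<phi>_def S T)
      show "u i \<otimes> u (Suc i) [^] int k = u (Suc i) [^] int k \<otimes> u i"
        using u_comm[of i "Suc i" 1] i by simp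
    qed (use i u_centre[of i 1] u_centre[of "Suc i" "int k"] in \<open>auto simp: int_pow_pow\<close>)
    then show ?thesis using i by (simp add: int_pow_pow)
  qed
  have zero_mem: "u 0 [^] int (k * k) \<in> D"
  proof -
    define y where "y = u 0 [^] (- int k) \<otimes> u 1 [^] (- int k * int k)"
    have pow: "y [^] i = u 0 [^] (- int k * i) \<otimes> u 1 [^] (- int k * int k * i)" for i :: int
      using r(2) u_comm by (simp add: y_def int_pow_mult_distrib int_pow_pow)
    have "(u 0 \<otimes> u 1 [^] int k) [^] (- int k) = y"
      using r(2) int_pow_mult_distrib[of "u 0" "u 1 [^] int k" "- int k"] u_comm[of 0 1 1 "int k"]
      by (simp add: y_def int_pow_pow)
    then have "\<phi> (u r) = u r \<otimes> y"
      using r(2) S(2)[of 0] by (simp add: \<phi>_def T(2) S(3) S.hom_int_pow)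
    moreover have y_centre: "y \<in> centre G"
      unfolding y_def using u_centre[of 0 "- 1"] u_centre[of 1 "- int k"] r(2)
      by (intro subgroup.m_closed[OF centre_subgroup]) simp_all
    moreover have "u r \<otimes> y = y \<otimes> u r" using centre_comm[OF y_centre, of "u r"] by simp
    moreover have "y [^] int k \<in> centre G"
      using int_pow_closed_subgroup[OF centre_subgroup y_centre] .
    ultimately have y: "y [^] int k \<in> D"
      unfolding D_def using r(2) u_centre[of r 1]
      by (intro pow_mem_twist_centre[OF \<phi>_hom, of "u r"]) (auto simp: y_def)
    \<comment> \<open>\<open>y [^] int k\<close> is the inverse of the wanted power of \<open>u 0\<close>, up to a power of \<open>u 1\<close> known to be in \<open>D\<close>\<close>
    have "(u 1 [^] int (k * k)) [^] (- int k) \<in> D"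
      using int_pow_closed_subgroup[OF D Suc_mem[OF r(2)]] by simp
    moreover have "(u 1 [^] int (k * k)) [^] (- int k) \<otimes> inv (y [^] int k) = u 0 [^] int (k * k)"
      using r(2) by (simp add: pow int_pow_pow inv_mult_group m_assoc[symmetric] int_pow_neg)
    ultimately show ?thesis using y D.m_closed D.m_inv_closed by metis
  qed
  have "t p [^] int (k * k) \<in> D" if p: "p \<in> P" for p
  proof -
    obtain i where "i \<le> r" "p = f i" using p f(1) by (auto simp: less_Suc_eq_le)
    then show ?thesis using zero_mem Suc_mem by (cases i) (auto simp: u_def)
  qed
  moreover have "D \<subseteq> centre G" by (auto simp: D_def twist_centre_def)
  ultimately have "finite ((\<lambda>x. D #> x) ` carrier G)"
    using D k_pos by (intro finite_mod_central[of D "k * k"]) auto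
  then have "reidemeister_number G \<phi> \<noteq> \<infinity>"
    unfolding D_def by (intro reidemeister_number_finite group_axioms \<phi>_hom)
  then show ?thesis using \<phi> by (auto simp: has_R_infinity_def)
qed

end

section \<open>The nilpotent quotients\<close>

text \<open>
  For \<open>b = a\<^bsup>m\<^esup>\<close> the commutator \<open>b t b\<inverse> t\<inverse>\<close> equals \<open>a\<^bsup>m - q m\<^esup>\<close>, so each step of the lower
  central series contributes one more factor \<open>q - 1\<close> to the exponent.
\<close>

lemma (in group) pow_mem_lower_central:
  assumes "a \<in> carrier G" "t \<in> carrier G" "t \<otimes> a \<otimes> inv t = a [^] (q::nat)" "q \<ge> 1"
  shows "a [^] ((q - 1) ^ c) \<in> lower_central G (Suc c)"
proof (induction c)
  case 0
  then show ?case using assms(1) by simp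
next
  case (Suc c)
  let ?m = "int ((q - 1) ^ c)"
  interpret N: normal "lower_central G (Suc (Suc c))" G by (rule lower_central_normal)
  let ?b = "a [^] ?m"
  have conj: "t \<otimes> inv ?b \<otimes> inv t = a [^] (- (int q * ?m))"
  proof -
    have "t \<otimes> a [^] (- ?m) \<otimes> inv t = (a [^] int q) [^] (- ?m)"
      using assms(1-3) by (simp add: int_pow_conjugate int_pow_int)
    then show ?thesis using assms(1) by (simp add: int_pow_neg int_pow_pow)
  qed
  have "?b \<in> lower_central G (Suc c)" using Suc by (simp only: int_pow_int)
  then have "?b \<otimes> t \<otimes> inv ?b \<otimes> inv t \<in> lower_central G (Suc (Suc c))"
    unfolding lower_central.simps commutator_subgroup_def
    using assms(2) by (intro generate.incl) blast
  moreover have "?b \<otimes> t \<otimes> inv ?b \<otimes> inv t = a [^] (- int ((q - 1) ^ Suc c))"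
  proof -
    have "?b \<otimes> t \<otimes> inv ?b \<otimes> inv t = ?b \<otimes> (t \<otimes> inv ?b \<otimes> inv t)"
      using assms(1,2) by (simp add: m_assoc)
    also have "\<dots> = a [^] (?m - int q * ?m)"
      unfolding conj using int_pow_mult[OF assms(1), of ?m "- (int q * ?m)"] by simp
    also have "?m - int q * ?m = - int ((q - 1) ^ Suc c)"
      using assms(4) by (simp add: of_nat_diff algebra_simps)
    finally show ?thesis .
  qed
  ultimately have "inv (a [^] (- int ((q - 1) ^ Suc c))) \<in> lower_central G (Suc (Suc c))"
    using N.m_inv_closed by metis
  moreover have "inv (a [^] (- int ((q - 1) ^ Suc c))) = a [^] ((q - 1) ^ Suc c)"
    using assms(1) by (simp only: int_pow_neg_int inv_inv nat_pow_closed)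
  ultimately show ?case by simp
qed

lemma (in group) conjugate_pow_nat:
  assumes "x \<in> carrier G" "y \<in> carrier G" "y \<otimes> x \<otimes> inv y = x [^] (q::nat)"
  shows "y [^] (n::nat) \<otimes> x \<otimes> inv (y [^] n) = x [^] (q ^ n)"
proof (induction n)
  case (Suc n)
  have "y [^] Suc n \<otimes> x \<otimes> inv (y [^] Suc n) = y [^] n \<otimes> (y \<otimes> x \<otimes> inv y) \<otimes> inv (y [^] n)"
    using assms(1,2) by (simp add: m_assoc inv_mult_group)
  also have "\<dots> = (y [^] n \<otimes> x \<otimes> inv (y [^] n)) [^] q"
    using assms(1,2) int_pow_conjugate[of x "y [^] n" "int q"] by (simp add: assms(3) int_pow_int)
  also have "\<dots> = x [^] (q ^ Suc n)"
    using assms(1) by (simp add: Suc nat_pow_pow mult.commute)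
  finally show ?case .
qed (use assms in simp)

lemma (in group) commute_if_pow_cong_1:
  assumes "x \<in> carrier G" "y \<in> carrier G" "y \<otimes> x \<otimes> inv y = x [^] (q::nat)"
    and "x [^] (m::nat) = \<one>" "[q ^ n = 1] (mod m)"
  shows "y [^] (n::nat) \<otimes> x = x \<otimes> y [^] n"
proof -
  have "x [^] j = x [^] (j mod m)" for j :: nat
  proof -
    have "x [^] j = x [^] (m * (j div m) + j mod m)" by simp
    also have "\<dots> = (x [^] m) [^] (j div m) \<otimes> x [^] (j mod m)"
      using assms(1) by (simp only: nat_pow_mult nat_pow_pow)
    also have "\<dots> = x [^] (j mod m)" using assms(1,4) by simp
    finally show ?thesis .
  qed
  then have "x [^] (q ^ n) = x [^] (1::nat)"
    using assms(5) unfolding cong_def by metis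
  then have "y [^] n \<otimes> x \<otimes> inv (y [^] n) = x"
    using conjugate_pow_nat[OF assms(1-3)] assms(1) by simp
  then show ?thesis
    using assms(1,2) by (metis inv_solve_right m_closed nat_pow_closed)
qed

lemma power_exponent_cong_1:
  fixes c :: nat
  assumes "finite P" "\<And>p. p \<in> P \<Longrightarrow> q p \<ge> (2::nat)"
  obtains k where "k > 0" "\<And>p. p \<in> P \<Longrightarrow> [q p ^ k = 1] (mod (q p - 1) ^ c)"
proof
  \<comment> \<open>Euler's theorem applies because \<open>q p\<close> is coprime to \<open>q p - 1\<close>; the product serves all \<open>p\<close> at once.\<close>
  define f where "f p = totient ((q p - 1) ^ c)" for p
  have pos: "f p > 0" if "p \<in> P" for p using assms(2)[OF that] by (simp add: f_def)
  show "prod f P > 0" using pos by (simp add: prod_pos)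
  fix p assume p: "p \<in> P"
  have "coprime (q p - 1) (q p)" using assms(2)[OF p] coprime_diff_one_left_nat[of "q p"] by simp
  then have "[q p ^ f p = 1] (mod (q p - 1) ^ c)"
    unfolding f_def by (intro euler_theorem) (simp add: coprime_commute)
  moreover have "f p dvd prod f P" using p assms(1) by (simp add: dvd_prodI)
  then obtain m where "prod f P = f p * m" by (elim dvdE)
  ultimately show "[q p ^ prod f P = 1] (mod (q p - 1) ^ c)"
    using cong_pow[of "q p ^ f p" 1 _ m] by (simp add: power_mult)
qed

text \<open>
  Endomorphisms of the quotient come from homomorphisms of the presented group into the quotient.
  These automatically kill the subgroup that is divided out, because homomorphisms map the lower
  central series into the lower central series and that of the quotient has become trivial.
\<close>

lemma nilpotent_quotient_torsion_gsbs:
  fixes n c :: nat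
  assumes "prime_factors n \<noteq> {}"
  defines "Q \<equiv> GSBS n Mod lower_central (GSBS n) (c + 1)"
  shows "\<exists>a t k. torsion_gsbs Q (prime_factors n) (\<lambda>p. p ^ multiplicity p n) a t k"
proof -
  let ?G = "GSBS n" and ?N = "lower_central (GSBS n) (c + 1)" and ?P = "prime_factors n"
  let ?S = "gsbs_gens n" and ?R = "gsbs_rels n"
  let ?q = "\<lambda>p. p ^ multiplicity p n"
  interpret G: group ?G by (rule group_GSBS)
  interpret N: normal ?N ?G by (rule G.lower_central_normal)
  interpret Q: group Q unfolding Q_def by (rule N.factorgroup_is_group)
  define proj where "proj x = ?N #>\<^bsub>?G\<^esub> x" for x
  interpret proj: group_hom ?G Q proj
    using N.r_coset_hom_Mod group_GSBS Q.group_axioms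
    by (simp add: group_hom_def group_hom_axioms_def Q_def proj_def[abs_def])
  have proj_surj: "proj ` carrier ?G = carrier Q"
    by (simp add: Q_def proj_def[abs_def] carrier_FactGroup)
  define g where "g = proj \<circ> pres_gen ?S ?R"
  have gens: "pres_gen ?S ?R x \<in> carrier ?G" if "x \<in> ?S" for x
    using pres_gen_closed[OF that] by (simp add: GSBS_def)
  then have g: "g \<in> ?S \<rightarrow> carrier Q" by (auto simp: g_def)
  define a where "a = g Gen_a"
  define t where "t p = g (Gen_t p)" for p
  have S: "Gen_a \<in> ?S" "\<And>p. p \<in> ?P \<Longrightarrow> Gen_t p \<in> ?S" by (auto simp: gsbs_gens_def)
  have a: "a \<in> carrier Q" and t: "\<And>p. p \<in> ?P \<Longrightarrow> t p \<in> carrier Q"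
    using g S by (auto simp: a_def t_def Pi_iff)
  have rel: "eval_word Q g u = eval_word Q g v" if "(u, v) \<in> ?R" for u v
  proof -
    have uv: "u \<in> words ?S" "v \<in> words ?S" using that gsbs_rels_words by blast+
    have "eval_word ?G (pres_gen ?S ?R) u = eval_word ?G (pres_gen ?S ?R) v"
      unfolding GSBS_def by (rule pres_gen_relation[OF that uv])
    then have "proj (eval_word ?G (pres_gen ?S ?R) u) = proj (eval_word ?G (pres_gen ?S ?R) v)"
      by simp
    moreover have "proj (eval_word ?G (pres_gen ?S ?R) w) = eval_word Q g w" if "w \<in> words ?S" for w
      unfolding g_def using gens
      by (intro eval_word_hom[OF group_GSBS Q.group_axioms proj.homh _ that]) auto
    ultimately show ?thesis using uv by simp
  qed
  have t_comm: "t p \<otimes>\<^bsub>Q\<^esub> t s = t s \<otimes>\<^bsub>Q\<^esub> t p" if "p \<in> ?P" "s \<in> ?P" for p s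
  proof (cases "p = s")
    case False
    then have "([(Gen_t p, True), (Gen_t s, True)], [(Gen_t s, True), (Gen_t p, True)]) \<in> ?R"
      using that by (auto simp: gsbs_rels_def)
    from rel[OF this] show ?thesis using that t by (simp add: t_def)
  qed simp
  have t_a: "t p \<otimes>\<^bsub>Q\<^esub> a \<otimes>\<^bsub>Q\<^esub> inv\<^bsub>Q\<^esub> t p = a [^]\<^bsub>Q\<^esub> ?q p" if "p \<in> ?P" for p
  proof -
    have "([(Gen_t p, True), (Gen_a, True), (Gen_t p, False)], replicate (?q p) (Gen_a, True)) \<in> ?R"
      using that by (auto simp: gsbs_rels_def)
    from rel[OF this] show ?thesis
      using that t a by (simp add: t_def a_def Q.eval_word_replicate Q.m_assoc)
  qed
  have q2: "?q p \<ge> 2" if "p \<in> ?P" for p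
  proof -
    have "prime p" "multiplicity p n > 0"
      using that by (auto simp: prime_factors_multiplicity)
    then show ?thesis
      using prime_ge_2_nat[of p] self_le_power[of p "multiplicity p n"] by linarith
  qed
  have "lower_central Q (c + 1) = {\<one>\<^bsub>Q\<^esub>}"
  proof -
    have "lower_central Q (c + 1) = proj ` ?N"
      using epi_lower_central[OF group_GSBS Q.group_axioms proj.homh proj_surj] .
    also have "\<dots> = {\<one>\<^bsub>Q\<^esub>}"
    proof -
      have "proj x = \<one>\<^bsub>Q\<^esub>" if "x \<in> ?N" for x
        unfolding proj_def N.rcos_const[OF G.group_axioms that] by (simp add: Q_def FactGroup_def)
      then show ?thesis using N.one_closed by auto
    qed
    finally show ?thesis .
  qed
  then have nil: "a [^]\<^bsub>Q\<^esub> ((?q p - 1) ^ c) = \<one>\<^bsub>Q\<^esub>" if "p \<in> ?P" for p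
    using Q.pow_mem_lower_central[OF a t[OF that] t_a[OF that], of c] q2[OF that] by simp
  obtain k where k: "k > 0" "\<And>p. p \<in> ?P \<Longrightarrow> [?q p ^ k = 1] (mod (?q p - 1) ^ c)"
    using power_exponent_cong_1[of ?P ?q c] q2 by auto
  have "torsion_gsbs Q ?P ?q a t k"
  proof
    show "finite ?P" by simp
    show "k > 0" by fact
    show "a \<in> carrier Q" by fact
    show "t p \<in> carrier Q" if "p \<in> ?P" for p using t that .
    show "t p \<otimes>\<^bsub>Q\<^esub> t s = t s \<otimes>\<^bsub>Q\<^esub> t p" if "p \<in> ?P" "s \<in> ?P" for p s using t_comm that .
    show "t p \<otimes>\<^bsub>Q\<^esub> a \<otimes>\<^bsub>Q\<^esub> inv\<^bsub>Q\<^esub> t p = a [^]\<^bsub>Q\<^esub> ?q p" if "p \<in> ?P" for p using t_a that .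
    show "\<exists>m>0. a [^]\<^bsub>Q\<^esub> (m::nat) = \<one>\<^bsub>Q\<^esub>"
    proof -
      obtain p where p: "p \<in> ?P" using assms(1) by blast
      have "(?q p - 1) ^ c > 0" using q2[OF p] by simp
      with nil[OF p] show ?thesis by blast
    qed
    show "t p [^]\<^bsub>Q\<^esub> k \<otimes>\<^bsub>Q\<^esub> a = a \<otimes>\<^bsub>Q\<^esub> t p [^]\<^bsub>Q\<^esub> k" if "p \<in> ?P" for p
      using Q.commute_if_pow_cong_1[OF a t[OF that] t_a[OF that] nil[OF that] k(2)[OF that]] .
    show "carrier Q = generate Q (insert a (t ` ?P))"
    proof -
      have "carrier ?G = generate ?G (pres_gen ?S ?R ` ?S)"
        unfolding GSBS_def by (rule presented_group_generate)
      moreover have "proj ` pres_gen ?S ?R ` ?S = insert a (t ` ?P)"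
        by (auto simp: gsbs_gens_def a_def t_def g_def)
      ultimately show ?thesis
        using generate_quotient[OF N.normal_axioms, of "pres_gen ?S ?R ` ?S"] gens
        by (simp add: Q_def proj_def[abs_def] image_subset_iff)
    qed
    fix \<tau> assume \<tau>: "\<tau> \<in> ?P \<rightarrow> carrier Q"
      and comm: "\<And>p s. p \<in> ?P \<Longrightarrow> s \<in> ?P \<Longrightarrow> \<tau> p \<otimes>\<^bsub>Q\<^esub> \<tau> s = \<tau> s \<otimes>\<^bsub>Q\<^esub> \<tau> p"
      and conj: "\<And>p. p \<in> ?P \<Longrightarrow> \<tau> p \<otimes>\<^bsub>Q\<^esub> a \<otimes>\<^bsub>Q\<^esub> inv\<^bsub>Q\<^esub> \<tau> p = a [^]\<^bsub>Q\<^esub> ?q p"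
    define f where "f x = (case x of Gen_a \<Rightarrow> a | Gen_t p \<Rightarrow> \<tau> p)" for x
    have f_simps [simp]: "f Gen_a = a" "f (Gen_t p) = \<tau> p" for p by (simp_all add: f_def)
    have \<tau>_closed [simp]: "\<tau> p \<in> carrier Q" if "p \<in> ?P" for p using \<tau> that by auto
    have "f \<in> ?S \<rightarrow> carrier Q" using a \<tau> by (auto simp: gsbs_gens_def)
    moreover have "eval_word Q f u = eval_word Q f v" if "(u, v) \<in> ?R" for u v
      using that a comm conj
      by (auto simp: gsbs_rels_def Q.eval_word_replicate Q.m_assoc[symmetric] simp del: in_prime_factors_iff)
    ultimately obtain h where "h \<in> hom (presented_group ?S ?R) Q"
      "\<And>x. x \<in> ?S \<Longrightarrow> h (pres_gen ?S ?R x) = f x"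
      using presented_group_lift[OF Q.group_axioms, of f ?S ?R] by blast
    then have h: "h \<in> hom ?G Q" "\<And>x. x \<in> ?S \<Longrightarrow> h (pres_gen ?S ?R x) = f x"
      by (auto simp: GSBS_def)
    interpret h: group_hom ?G Q h
      using h(1) group_GSBS Q.group_axioms by (simp add: group_hom_def group_hom_axioms_def)
    have "h ` ?N \<subseteq> {\<one>\<^bsub>Q\<^esub>}"
      using hom_lower_central[OF group_GSBS Q.group_axioms h(1), of "c + 1"]
        \<open>lower_central Q (c + 1) = {\<one>\<^bsub>Q\<^esub>}\<close> by simp
    then have "?N \<subseteq> kernel ?G Q h" using N.subset by (auto simp: kernel_def)
    then obtain \<phi> where \<phi>: "\<phi> \<in> hom Q Q" "\<And>x. x \<in> carrier ?G \<Longrightarrow> \<phi> (proj x) = h x"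
      using h.FactGroup_universal_kernel[OF N.normal_axioms] unfolding Q_def proj_def by blast
    have "\<phi> (g x) = f x" if "x \<in> ?S" for x
      using gens[OF that] that \<phi>(2) h(2) by (simp add: g_def)
    then show "\<exists>\<phi>\<in>hom Q Q. \<phi> a = a \<and> (\<forall>p\<in>?P. \<phi> (t p) = \<tau> p)"
      using \<phi>(1) S by (intro bexI[of _ \<phi>]) (auto simp: a_def t_def)
  qed
  then show ?thesis by blast
qed

theorem theorem1:
  fixes n :: nat
  assumes "n \<ge> 1"
    and "card (prime_factors n) \<ge> 2"
  shows "R_infinity_nilpotency_degree (GSBS n) = \<infinity> \<and>
    (\<forall>c\<ge>1. \<not> has_R_infinity (GSBS n Mod lower_central (GSBS n) (c + 1)))"
proof -
  have "prime_factors n \<noteq> {}" using assms(2) by auto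
  have no: "\<not> has_R_infinity (GSBS n Mod lower_central (GSBS n) (c + 1))" for c :: nat
  proof -
    obtain a t k where "torsion_gsbs (GSBS n Mod lower_central (GSBS n) (c + 1))
        (prime_factors n) (\<lambda>p. p ^ multiplicity p n) a t k"
      using nilpotent_quotient_torsion_gsbs[OF \<open>prime_factors n \<noteq> {}\<close>, of c] by blast
    then show ?thesis by (rule torsion_gsbs.not_R_infinity) (rule assms(2))
  qed
  then show ?thesis by (simp add: R_infinity_nilpotency_degree_def top_enat_def)
qed

end
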